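(* Let $G$ be a finite abelian group with Sylow subgroups $P_1, P_2, \dots, P_q$ (one for each prime divisor of $|G|$). Then the independence number of the enhanced power graph of $G$ is $$\alpha(\mathcal{P}_e(G)) = \prod_{i=1}^{q} \mu(P_i),$$ where $\mu(P_i)$ is the number of maximal cyclic subgroups of $P_i$, and it is given by the following formula: if $P$ is one of the $P_i$, a $p$-group with $P \cong \mathbb{Z}_{p^{\alpha_1}}^{m_1} \times \cdots \times \mathbb{Z}_{p^{\alpha_s}}^{m_s}$, where $\alpha_1 > \dots > \alpha_s$ and $m_1,\dots,m_s$ are positive integers, and $n_j = p^{\sum_{l=1}^{j} m_l\alpha_l}$, $r_j = \sum_{l=1}^{j} m_l$ for $1\le j\le s$, $r_0 = 0$, $n = n_s$, $r = r_s$, then $$\mu(P) = \sum_{t=1}^{r} \frac{n}{p^{t-1}} \left\{ \frac{p^{(r_k-1)\alpha_k}}{n_k} + \mu_k \right\},$$ where for each $t$ the index $k=k(t)$ satisfies $r_{k-1} < t \leq r_k$, and $\mu_1 = 0$, while for $k>1$ $$\mu_k = \sum_{j=1}^{k-1} \frac{p^{r_j}-1}{n_j} \sum_{\beta=\alpha_{j+1}}^{\alpha_j - 1} p^{(r_j-1)\beta}.$$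
   Context: The enhanced power graph $\mathcal{P}_e(G)$ of a group $G$ is the simple undirected graph with vertex set $G$ in which two distinct vertices are adjacent if and only if they belong to a common cyclic subgroup of $G$. A maximal cyclic subgroup of a group is a cyclic subgroup not properly contained in any other cyclic subgroup. $\mathbb{Z}_n^m$ denotes the direct product of $m$ copies of the group $\mathbb{Z}_n$ of integers modulo $n$. The independence number $\alpha(\Gamma)$ of a graph $\Gamma$ is the largest cardinality of a set of pairwise non-adjacent vertices. *)

theory Defs
  imports
    Complex_Main
    "HOL-Computational_Algebra.Primes"
    "HOL-Algebra.Product_Groups"
    "Graph_Theory.Pair_Digraph"
begin

definition cyclic_subgroup :: "'a set \<Rightarrow> ('a, 'b) monoid_scheme \<Rightarrow> bool" where
  "cyclic_subgroup C G \<longleftrightarrow> subgroup C G \<and> cyclic_group (G\<lparr>carrier := C\<rparr>)"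

definition maximal_cyclic_subgroup :: "'a set \<Rightarrow> ('a, 'b) monoid_scheme \<Rightarrow> bool" where
  "maximal_cyclic_subgroup C G \<longleftrightarrow>
     cyclic_subgroup C G \<and> \<not> (\<exists>D. cyclic_subgroup D G \<and> C \<subset> D)"

definition num_maximal_cyclic :: "('a, 'b) monoid_scheme \<Rightarrow> nat" where
  "num_maximal_cyclic G = card {C. maximal_cyclic_subgroup C G}"

definition sylow_subgroup :: "nat \<Rightarrow> 'a set \<Rightarrow> ('a, 'b) monoid_scheme \<Rightarrow> bool" where
  "sylow_subgroup p P G \<longleftrightarrow>
     prime p \<and> subgroup P G \<and> card P = p ^ multiplicity p (order G)"

text \<open>
  A simple undirected graph is a symmetric loop-free relation on its vertices, as in
  the locale \<^locale>\<open>pair_graph\<close>.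
\<close>

definition enhanced_power_graph :: "('a, 'b) monoid_scheme \<Rightarrow> 'a pair_pre_digraph" where
  "enhanced_power_graph G =
     \<lparr>pverts = carrier G,
      parcs = {(x, y). x \<in> carrier G \<and> y \<in> carrier G \<and> x \<noteq> y \<and>
                       (\<exists>C. cyclic_subgroup C G \<and> x \<in> C \<and> y \<in> C)}\<rparr>"

lemma pair_graph_enhanced_power_graph:
  assumes "finite (carrier G)"
  shows "pair_graph (enhanced_power_graph G)"
proof -
  have "finite (parcs (enhanced_power_graph G))"
    by (rule finite_subset[of _ "carrier G \<times> carrier G"])
       (use assms in \<open>auto simp: enhanced_power_graph_def\<close>)
  moreover have "symmetric (with_proj (enhanced_power_graph G))"
    by (auto simp: symmetric_def sym_def enhanced_power_graph_def)
  ultimately show ?thesis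
    using assms by unfold_locales (auto simp: enhanced_power_graph_def)
qed

definition independent_set :: "'v pair_pre_digraph \<Rightarrow> 'v set \<Rightarrow> bool" where
  "independent_set \<Gamma> S \<longleftrightarrow>
     S \<subseteq> pverts \<Gamma> \<and> (\<forall>x\<in>S. \<forall>y\<in>S. x \<noteq> y \<longrightarrow> (x, y) \<notin> parcs \<Gamma>)"

text \<open>Meaningful for graphs with finitely many vertices only.\<close>

definition independence_number :: "'v pair_pre_digraph \<Rightarrow> nat" where
  "independence_number \<Gamma> = Max {card S |S. independent_set \<Gamma> S}"

definition cyclic_power :: "nat \<Rightarrow> nat \<Rightarrow> (nat \<Rightarrow> int) monoid" where
  "cyclic_power n m = product_group {1..m} (\<lambda>_. integer_mod_group n)"

text \<open>
  The group \<open>\<int>\<^bsub>p^\<alpha>\<^sub>1\<^esub>\<^bsup>m\<^sub>1\<^esup> \<times> \<dots> \<times> \<int>\<^bsub>p^\<alpha>\<^sub>s\<^esub>\<^bsup>m\<^sub>s\<^esup>\<close>. The sequences \<open>\<alpha>\<close> and \<open>m\<close> are functions on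
  \<^typ>\<open>nat\<close> of which only the values at \<open>1, \<dots>, s\<close> matter, here and below.
\<close>

definition abelian_p_group ::
  "nat \<Rightarrow> nat \<Rightarrow> (nat \<Rightarrow> nat) \<Rightarrow> (nat \<Rightarrow> nat) \<Rightarrow> (nat \<Rightarrow> nat \<Rightarrow> int) monoid" where
  "abelian_p_group p s \<alpha> m = product_group {1..s} (\<lambda>i. cyclic_power (p ^ \<alpha> i) (m i))"

definition r_sum :: "(nat \<Rightarrow> nat) \<Rightarrow> nat \<Rightarrow> nat" where
  "r_sum m j = (\<Sum>l=1..j. m l)"

definition n_prod :: "nat \<Rightarrow> (nat \<Rightarrow> nat) \<Rightarrow> (nat \<Rightarrow> nat) \<Rightarrow> nat \<Rightarrow> nat" where
  "n_prod p \<alpha> m j = p ^ (\<Sum>l=1..j. m l * \<alpha> l)"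

text \<open>
  The index \<open>k(t)\<close>. It exists and is unique for \<open>1 \<le> t \<le> r\<^sub>s\<close>, since the \<open>r\<^sub>j\<close> increase from
  \<open>r\<^sub>0 = 0\<close>.
\<close>

definition block_index :: "nat \<Rightarrow> (nat \<Rightarrow> nat) \<Rightarrow> nat \<Rightarrow> nat" where
  "block_index s m t = (THE k. 1 \<le> k \<and> k \<le> s \<and> r_sum m (k - 1) < t \<and> t \<le> r_sum m k)"

text \<open>
  For positive \<open>m\<close> and strictly decreasing positive \<open>\<alpha>\<close>, none of the natural-number
  subtractions in the next two definitions truncates.
\<close>

definition mu_term :: "nat \<Rightarrow> (nat \<Rightarrow> nat) \<Rightarrow> (nat \<Rightarrow> nat) \<Rightarrow> nat \<Rightarrow> real" where
  "mu_term p \<alpha> m k =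
     (if k = 1 then 0
      else \<Sum>j=1..k - 1. (real p ^ r_sum m j - 1) / real (n_prod p \<alpha> m j) *
             (\<Sum>\<beta>=\<alpha> (j + 1)..\<alpha> j - 1. real p ^ ((r_sum m j - 1) * \<beta>)))"

definition mu_formula :: "nat \<Rightarrow> nat \<Rightarrow> (nat \<Rightarrow> nat) \<Rightarrow> (nat \<Rightarrow> nat) \<Rightarrow> real" where
  "mu_formula p s \<alpha> m =
     (\<Sum>t=1..r_sum m s. real (n_prod p \<alpha> m s) / real p ^ (t - 1) *
        (let k = block_index s m t in
           real p ^ ((r_sum m k - 1) * \<alpha> k) / real (n_prod p \<alpha> m k) + mu_term p \<alpha> m k))"

end

theory Submission
  imports
    Defs
    "HOL-Algebra.Multiplicative_Group"
    "HOL-Number_Theory.Totient"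
begin

text \<open>
  In a finite group every element lies in a maximal cyclic subgroup, an independent set meets each
  of these at most once, and picking one generator from each gives an independent set; so the
  independence number is the number of maximal cyclic subgroups. In an abelian group whose exponent
  divides \<open>m n\<close> with \<open>m\<close> and \<open>n\<close> coprime, the idempotents of \<open>\<int>/(m n)\<close> split a cyclic subgroup
  into its \<open>m\<close>-torsion and \<open>n\<close>-torsion parts, and this isomorphism of ordered sets makes the
  number multiplicative.

  In a nontrivial abelian \<open>p\<close>-group, \<open>x\<close> generates a maximal cyclic subgroup iff it is not a
  \<open>p\<close>-th power, and a cyclic group of order \<open>p ^ b\<close> has \<open>p ^ (b - 1) * (p - 1)\<close> generators. So it
  suffices to count the elements killed by \<open>p ^ b\<close>, among all elements and among \<open>p\<close>-th powers, in a
  product of cyclic groups. Summation by parts over \<open>b\<close>, and over the blocks of equal exponents,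
  turns the resulting sum into the closed formula.
\<close>

section \<open>Cyclic subgroups and the independence number\<close>

text \<open>Natural exponents are enough: in a finite group this set is the subgroup generated by
  \<open>x\<close>.\<close>

definition powers :: "('a, 'b) monoid_scheme \<Rightarrow> 'a \<Rightarrow> 'a set" where
  "powers G x = range (\<lambda>k::nat. x [^]\<^bsub>G\<^esub> k)"

lemma (in group) powers_eq_generate:
  assumes "finite (carrier G)" "x \<in> carrier G"
  shows "powers G x = generate G {x}"
  unfolding powers_def generate_pow_on_finite_carrier[OF assms] by (simp add: full_SetCompr_eq)

text \<open>\<open>cyclic_group\<close> speaks of integer powers inside the restricted structure.
  These agree with integer powers in \<open>G\<close>, which finiteness reduces to natural
  ones.\<close>

lemma (in group) cyclic_subgroup_iff:
  assumes fin: "finite (carrier G)"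
  shows "cyclic_subgroup C G \<longleftrightarrow> (\<exists>x\<in>carrier G. C = powers G x)"
proof
  assume "cyclic_subgroup C G"
  then have C: "subgroup C G" and "cyclic_group (G\<lparr>carrier := C\<rparr>)"
    by (auto simp: cyclic_subgroup_def)
  interpret C: group "G\<lparr>carrier := C\<rparr>"
    using C by (rule subgroup_imp_group)
  obtain x where x: "x \<in> C" "C = range (\<lambda>n::int. x [^]\<^bsub>G\<lparr>carrier := C\<rparr>\<^esub> n)"
    using \<open>cyclic_group _\<close>[unfolded C.cyclic_group] by force
  have xG: "x \<in> carrier G" using subgroup.mem_carrier[OF C x(1)] .
  have "range (\<lambda>n::int. x [^]\<^bsub>G\<lparr>carrier := C\<rparr>\<^esub> n) = generate G {x}"
    unfolding generate_pow[OF xG] int_pow_consistent[OF C x(1), symmetric] by blast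
  then have "C = powers G x"
    using x(2) powers_eq_generate[OF fin xG] by simp
  then show "\<exists>x\<in>carrier G. C = powers G x" using xG by blast
next
  assume "\<exists>x\<in>carrier G. C = powers G x"
  then obtain x where x: "x \<in> carrier G" "C = powers G x" by blast
  then have Cgen: "C = generate G {x}" by (simp only: powers_eq_generate[OF fin])
  then have C: "subgroup C G" using generate_is_subgroup[of "{x}"] x(1) by simp
  interpret C: group "G\<lparr>carrier := C\<rparr>"
    using C by (rule subgroup_imp_group)
  have xC: "x \<in> C" unfolding Cgen by (simp add: generate.incl)
  have "range (\<lambda>n::int. x [^]\<^bsub>G\<lparr>carrier := C\<rparr>\<^esub> n) = generate G {x}"
    unfolding generate_pow[OF x(1)] int_pow_consistent[OF C xC, symmetric] by blast
  then have "carrier (G\<lparr>carrier := C\<rparr>) = range (\<lambda>n::int. x [^]\<^bsub>G\<lparr>carrier := C\<rparr>\<^esub> n)"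
    using Cgen by simp
  moreover have "x \<in> carrier (G\<lparr>carrier := C\<rparr>)" using xC by simp
  ultimately have "cyclic_group (G\<lparr>carrier := C\<rparr>)"
    unfolding C.cyclic_group by (rule bexI)
  with C show "cyclic_subgroup C G" by (simp add: cyclic_subgroup_def)
qed

lemma (in group) subgroup_powers:
  assumes "finite (carrier G)" "x \<in> carrier G"
  shows "subgroup (powers G x) G"
  using assms by (simp add: powers_eq_generate generate_is_subgroup)

lemma (in group) powers_self: "x \<in> carrier G \<Longrightarrow> x \<in> powers G x"
  unfolding powers_def by (rule range_eqI[of _ _ 1]) simp

lemma (in group) cyclic_subgroup_powers:
  assumes "finite (carrier G)" "x \<in> carrier G"
  shows "cyclic_subgroup (powers G x) G"
  using assms by (auto simp: cyclic_subgroup_iff)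

lemma (in group) powers_minimal:
  assumes "subgroup C G" "x \<in> C"
  shows "powers G x \<subseteq> C"
proof -
  have "x [^] k \<in> C" for k :: nat
    by (induct k) (use assms in \<open>auto simp: subgroup.one_closed subgroup.m_closed\<close>)
  then show ?thesis by (auto simp: powers_def)
qed

lemma cyclic_subgroup_subset: "cyclic_subgroup C G \<Longrightarrow> C \<subseteq> carrier G"
  by (simp add: cyclic_subgroup_def subgroup.subset)

lemma cyclic_subgroup_restrict:
  assumes "group G" "subgroup H G"
  shows "cyclic_subgroup C (G\<lparr>carrier := H\<rparr>) \<longleftrightarrow> cyclic_subgroup C G \<and> C \<subseteq> H"
proof -
  interpret group G by fact
  have "subgroup C (G\<lparr>carrier := H\<rparr>) \<longleftrightarrow> subgroup C G \<and> C \<subseteq> H"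
    using incl_subgroup[OF assms(2)] subgroup_incl[OF _ assms(2)]
      subgroup.subset[of C "G\<lparr>carrier := H\<rparr>"] by auto
  then show ?thesis by (simp add: cyclic_subgroup_def conj_ac)
qed

lemma maximal_cyclic_subgroupD: "maximal_cyclic_subgroup C G \<Longrightarrow> cyclic_subgroup C G"
  by (simp add: maximal_cyclic_subgroup_def)

lemma maximal_cyclic_subgroup_eq:
  "\<lbrakk>maximal_cyclic_subgroup C G; cyclic_subgroup D G; C \<subseteq> D\<rbrakk> \<Longrightarrow> C = D"
  unfolding maximal_cyclic_subgroup_def by blast

lemma finite_maximal_cyclic:
  assumes "finite (carrier G)"
  shows "finite {C. maximal_cyclic_subgroup C G}"
proof (rule finite_subset)
  show "{C. maximal_cyclic_subgroup C G} \<subseteq> Pow (carrier G)"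
    by (blast dest: maximal_cyclic_subgroupD cyclic_subgroup_subset)
qed (simp add: assms)

lemma (in group) ex_maximal_cyclic:
  assumes fin: "finite (carrier G)" and x: "x \<in> carrier G"
  shows "\<exists>C. maximal_cyclic_subgroup C G \<and> x \<in> C"
proof -
  let ?S = "{C. cyclic_subgroup C G}"
  have "finite ?S"
    by (rule finite_subset[of _ "Pow (carrier G)"], blast dest: cyclic_subgroup_subset)
      (simp add: fin)
  moreover have "powers G x \<in> ?S" using cyclic_subgroup_powers[OF fin x] by simp
  ultimately obtain C where "C \<in> ?S" "powers G x \<subseteq> C" "\<forall>D\<in>?S. C \<subseteq> D \<longrightarrow> C = D"
    using finite_has_maximal2[of ?S "powers G x"] by metis
  then have "maximal_cyclic_subgroup C G" unfolding maximal_cyclic_subgroup_def by blast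
  moreover have "x \<in> C" using powers_self[OF x] \<open>powers G x \<subseteq> C\<close> by blast
  ultimately show ?thesis by blast
qed

lemma (in group) independence_number_enhanced_power_graph:
  assumes fin: "finite (carrier G)"
  shows "independence_number (enhanced_power_graph G) = num_maximal_cyclic G"
proof -
  let ?M = "{C. maximal_cyclic_subgroup C G}"
  let ?I = "{card S |S. independent_set (enhanced_power_graph G) S}"
  have finM: "finite ?M" by (rule finite_maximal_cyclic[OF fin])
  have upper: "card S \<le> card ?M" if S: "independent_set (enhanced_power_graph G) S" for S
  proof -
    have "S \<subseteq> carrier G" using S by (auto simp: independent_set_def enhanced_power_graph_def)
    \<comment> \<open>Each vertex of \<open>S\<close> chooses a maximal cyclic subgroup containing
      it. Two vertices with the same choice would be adjacent, so the choice is injective.\<close>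
    then obtain f where f: "\<And>x. x \<in> S \<Longrightarrow> maximal_cyclic_subgroup (f x) G \<and> x \<in> f x"
      using ex_maximal_cyclic[OF fin] by (metis subsetD)
    have "inj_on f S"
    proof (rule inj_onI, rule ccontr)
      fix x y assume "x \<in> S" "y \<in> S" "f x = f y" "x \<noteq> y"
      with f[of x] f[of y] have "cyclic_subgroup (f x) G" "x \<in> f x" "y \<in> f x"
        by (auto dest: maximal_cyclic_subgroupD)
      moreover have "x \<in> carrier G" "y \<in> carrier G"
        using \<open>S \<subseteq> carrier G\<close> \<open>x \<in> S\<close> \<open>y \<in> S\<close> by auto
      ultimately have "(x, y) \<in> parcs (enhanced_power_graph G)"
        using \<open>x \<noteq> y\<close> by (auto simp: enhanced_power_graph_def)
      then show False
        using S \<open>x \<in> S\<close> \<open>y \<in> S\<close> \<open>x \<noteq> y\<close> unfolding independent_set_def by blast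
    qed
    moreover have "f ` S \<subseteq> ?M" using f by auto
    ultimately show ?thesis using finM card_inj_on_le by blast
  qed
  have "\<forall>C\<in>?M. \<exists>x\<in>carrier G. C = powers G x"
    using cyclic_subgroup_iff[OF fin] maximal_cyclic_subgroupD by blast
  \<comment> \<open>\<open>g\<close> picks a generator of each maximal cyclic subgroup;
    \<open>powers G\<close> inverts it, so distinct subgroups give distinct vertices.\<close>
  then obtain g where "\<forall>C\<in>?M. g C \<in> carrier G \<and> C = powers G (g C)"
    unfolding bchoice_iff Bex_def by blast
  then have g: "g C \<in> carrier G" "powers G (g C) = C" if "C \<in> ?M" for C
    using that by simp_all
  have "inj_on g ?M"
    by (rule inj_on_inverseI[of _ "powers G"]) (rule g(2))
  then have card: "card (g ` ?M) = card ?M" by (rule card_image)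
  have indep: "independent_set (enhanced_power_graph G) (g ` ?M)"
    unfolding independent_set_def
  proof (intro conjI ballI impI notI)
    show "g ` ?M \<subseteq> pverts (enhanced_power_graph G)"
      using g by (auto simp: enhanced_power_graph_def)
    fix x y
    assume "x \<in> g ` ?M" "y \<in> g ` ?M" "x \<noteq> y" "(x, y) \<in> parcs (enhanced_power_graph G)"
    then obtain C D E where CD: "C \<in> ?M" "D \<in> ?M" "g C \<noteq> g D"
      and E: "cyclic_subgroup E G" "g C \<in> E" "g D \<in> E"
      by (auto simp: enhanced_power_graph_def)
    then have "subgroup E G" by (simp add: cyclic_subgroup_def)
    \<comment> \<open>A cyclic subgroup containing both generators contains both maximal cyclic
      subgroups, hence equals each of them.\<close>
    then have "powers G (g C) \<subseteq> E" "powers G (g D) \<subseteq> E"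
      using E by (simp_all add: powers_minimal)
    then have "C \<subseteq> E" "D \<subseteq> E" using g CD by blast+
    then have "C = E" "D = E"
      using CD E maximal_cyclic_subgroup_eq[of C G E] maximal_cyclic_subgroup_eq[of D G E]
      by simp_all
    then show False using CD by simp
  qed
  have "finite ?I"
    by (rule finite_subset[of _ "{..card ?M}"]) (auto dest: upper)
  moreover have "card ?M \<in> ?I"
    by (rule CollectI, rule exI[of _ "g ` ?M"], rule conjI[OF card[symmetric] indep])
  ultimately have "Max ?I = card ?M"
    by (intro Max_eqI) (auto dest: upper)
  then show ?thesis by (simp only: independence_number_def num_maximal_cyclic_def)
qed

section \<open>Splitting into coprime torsion parts\<close>

definition torsion :: "('a, 'b) monoid_scheme \<Rightarrow> nat \<Rightarrow> 'a set" where
  "torsion G n = {x \<in> carrier G. x [^]\<^bsub>G\<^esub> n = \<one>\<^bsub>G\<^esub>}"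

lemma (in comm_group) subgroup_torsion: "subgroup (torsion G n) G"
  by (rule subgroupI) (auto simp: torsion_def pow_mult_distrib m_comm nat_pow_inv intro: exI[of _ \<one>])

text \<open>The order of \<open>x\<close> divides \<open>m\<close>, so exponents matter only modulo
  \<open>m\<close>.\<close>

lemma (in group) pow_cong_torsion:
  fixes a b :: nat
  assumes "x \<in> torsion G m" "[a = b] (mod m)"
  shows "x [^] a = x [^] b"
proof -
  have x: "x \<in> carrier G" and "ord x dvd m"
    using assms(1) by (auto simp: torsion_def pow_eq_id)
  then have "[a = b] (mod (ord x))" using assms(2) cong_dvd_modulus_nat by blast
  then have "int (ord x) dvd int b - int a"
    using cong_int_iff cong_iff_dvd_diff cong_sym_eq by metis
  then have "x [^] (int a) = x [^] (int b)" using x by (simp add: int_pow_eq)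
  then show ?thesis by (simp add: int_pow_int)
qed

lemma (in group) pow_mem_torsion:
  assumes "x \<in> torsion G (m * n)"
  shows "x [^] n \<in> torsion G m"
  using assms by (auto simp: torsion_def nat_pow_pow mult.commute)

lemma (in group) torsion_mono: "m dvd n \<Longrightarrow> torsion G m \<subseteq> torsion G n"
  by (auto simp: torsion_def pow_eq_id dvd_trans)

text \<open>Expressing maximality inside the fixed group \<open>G\<close> lets subgroups of
  different torsion parts be intersected and multiplied in one ambient structure.\<close>

lemma maximal_cyclic_subgroup_restrict:
  assumes "group G" "subgroup H G"
  shows "maximal_cyclic_subgroup C (G\<lparr>carrier := H\<rparr>) \<longleftrightarrow>
    cyclic_subgroup C G \<and> C \<subseteq> H \<and> (\<forall>D. cyclic_subgroup D G \<longrightarrow> D \<subseteq> H \<longrightarrow> C \<subseteq> D \<longrightarrow> C = D)"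
  unfolding maximal_cyclic_subgroup_def cyclic_subgroup_restrict[OF assms] by blast

lemma set_mult_mono: "A \<subseteq> A' \<Longrightarrow> B \<subseteq> B' \<Longrightarrow> A <#>\<^bsub>G\<^esub> B \<subseteq> A' <#>\<^bsub>G\<^esub> B'"
  unfolding set_mult_def by blast

lemma (in group) subgroup_nat_pow_closed:
  assumes "subgroup C G" "x \<in> C"
  shows "x [^] (k::nat) \<in> C"
  using powers_minimal[OF assms] unfolding powers_def by blast

section \<open>Projections onto coprime torsion parts\<close>

context comm_group
begin

text \<open>Modulo \<open>m * n\<close>, \<open>e\<close> and \<open>f\<close> are complementary
  idempotents: on the \<open>m * n\<close>-torsion, the powers \<open>e\<close> and \<open>f\<close>
  are the projections onto the \<open>m\<close>-torsion and the \<open>n\<close>-torsion.\<close>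

context
  fixes m n e f :: nat
  assumes fin: "finite (carrier G)"
    and e: "[e = 1] (mod m)" "[e = 0] (mod n)"
    and f: "[f = 0] (mod m)" "[f = 1] (mod n)"
begin

lemma torsion_pow_idem:
  "x \<in> torsion G m \<Longrightarrow> x [^] e = x" "x \<in> torsion G m \<Longrightarrow> x [^] f = \<one>"
  "x \<in> torsion G n \<Longrightarrow> x [^] e = \<one>" "x \<in> torsion G n \<Longrightarrow> x [^] f = x"
  using pow_cong_torsion[OF _ e(1)] pow_cong_torsion[OF _ f(1)]
    pow_cong_torsion[OF _ e(2)] pow_cong_torsion[OF _ f(2)] by (auto simp: torsion_def)

text \<open>Since \<open>n\<close> divides \<open>e\<close>, \<open>x [^] e\<close> is a power of
  \<open>x [^] n\<close>, which \<open>m\<close> kills; \<open>f\<close> is treated in the same way.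
  The two projections multiply to \<open>x\<close> because \<open>e + f\<close> is 1 modulo
  \<open>m * n\<close>.\<close>

lemma torsion_decompose:
  assumes "x \<in> torsion G (m * n)"
  shows "x [^] e \<in> torsion G m" "x [^] f \<in> torsion G n" "x = x [^] e \<otimes> x [^] f"
proof -
  have x: "x \<in> carrier G" using assms by (simp add: torsion_def)
  have "n dvd e" "m dvd f" using e(2) f(1) by (simp_all add: cong_0_iff)
  then obtain e' f' where ef: "e = n * e'" "f = m * f'" by (elim dvdE)
  have "x [^] n \<in> torsion G m" "x [^] m \<in> torsion G n"
    using assms pow_mem_torsion[of x n m] pow_mem_torsion[of x m n] by (simp_all add: mult.commute)
  then show "x [^] e \<in> torsion G m" "x [^] f \<in> torsion G n"
    unfolding ef nat_pow_pow[OF x, symmetric]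
    by (simp_all add: subgroup_nat_pow_closed[OF subgroup_torsion])
  \<comment> \<open>Coprimality follows from the congruences: modulo the gcd, \<open>e\<close> is
    both 1 and 0.\<close>
  have "gcd m n dvd 1"
  proof -
    have "[e = 1] (mod gcd m n)" "[e = 0] (mod gcd m n)"
      using e by (auto elim: cong_dvd_modulus_nat)
    then have "[1 = (0::nat)] (mod gcd m n)" using cong_trans cong_sym by blast
    then show ?thesis by (simp add: cong_0_iff)
  qed
  then have "coprime m n" by (simp add: coprime_iff_gcd_eq_1)
  moreover have "[e + f = 1] (mod m)" "[e + f = 1] (mod n)"
    using cong_add[OF e(1) f(1)] cong_add[OF e(2) f(2)] by simp_all
  ultimately have "[e + f = 1] (mod (m * n))" by (simp add: coprime_cong_mult_nat)
  then have "x [^] (e + f) = x [^] (1::nat)" by (rule pow_cong_torsion[OF assms])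
  then show "x = x [^] e \<otimes> x [^] f" using x by (simp add: nat_pow_mult)
qed

text \<open>If \<open>x\<close> generates \<open>C\<close>, its projection \<open>x [^] e\<close>
  generates the intersection: a power \<open>x [^] k\<close> in the \<open>m\<close>-torsion is
  fixed by the projection, so it is a power of \<open>x [^] e\<close>.\<close>

lemma cyclic_subgroup_Int_torsion:
  assumes "cyclic_subgroup C G" "C \<subseteq> torsion G (m * n)"
  shows "cyclic_subgroup (C \<inter> torsion G m) G"
proof -
  obtain x where x: "x \<in> carrier G" "C = powers G x"
    using assms(1) cyclic_subgroup_iff[OF fin] by blast
  have xC: "x \<in> C" using x powers_self by simp
  have "C \<inter> torsion G m = powers G (x [^] e)"
  proof
    show "powers G (x [^] e) \<subseteq> C \<inter> torsion G m"
    proof (rule powers_minimal)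
      show "subgroup (C \<inter> torsion G m) G"
        using assms(1) subgroup_torsion subgroups_Inter_pair by (simp add: cyclic_subgroup_def)
      show "x [^] e \<in> C \<inter> torsion G m"
        using subgroup_nat_pow_closed[OF _ xC] torsion_decompose(1) xC assms
        by (auto simp: cyclic_subgroup_def)
    qed
    show "C \<inter> torsion G m \<subseteq> powers G (x [^] e)"
    proof
      fix y assume y: "y \<in> C \<inter> torsion G m"
      then obtain k :: nat where k: "y = x [^] k" using x by (auto simp: powers_def)
      have "y = y [^] e" using y torsion_pow_idem(1) by simp
      also have "\<dots> = (x [^] e) [^] k" using x(1) by (simp add: k nat_pow_pow mult.commute)
      finally show "y \<in> powers G (x [^] e)" by (auto simp: powers_def)
    qed
  qed
  then show ?thesis using cyclic_subgroup_powers[OF fin] x(1) by simp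
qed

text \<open>The product of generators \<open>a\<close> and \<open>b\<close> generates
  \<open>A <#> B\<close>, because its powers with exponents \<open>e\<close> and \<open>f\<close>
  recover \<open>a\<close> and \<open>b\<close>.\<close>

lemma cyclic_subgroup_set_mult:
  assumes A: "cyclic_subgroup A G" "A \<subseteq> torsion G m"
    and B: "cyclic_subgroup B G" "B \<subseteq> torsion G n"
  shows "cyclic_subgroup (A <#> B) G" "(A <#> B) \<inter> torsion G m = A"
proof -
  obtain a where a: "a \<in> carrier G" "A = powers G a" using A(1) cyclic_subgroup_iff[OF fin] by blast
  obtain b where b: "b \<in> carrier G" "B = powers G b" using B(1) cyclic_subgroup_iff[OF fin] by blast
  have AG: "subgroup A G" "subgroup B G" using A(1) B(1) by (auto simp: cyclic_subgroup_def)
  have one: "\<one> \<in> A" "\<one> \<in> B" using AG by (auto simp: subgroup.one_closed)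
  have carr: "x \<in> carrier G" if "x \<in> A \<or> x \<in> B" for x
    using that AG subgroup.mem_carrier by metis
  have ab: "a \<in> A" "b \<in> B" using a b powers_self by auto
  have pe: "(x \<otimes> y) [^] e = x" "(x \<otimes> y) [^] f = y" if "x \<in> A" "y \<in> B" for x y
  proof -
    have x: "x \<in> torsion G m" "y \<in> torsion G n" using that A(2) B(2) by auto
    then show "(x \<otimes> y) [^] e = x" "(x \<otimes> y) [^] f = y"
      using carr that torsion_pow_idem(1,2)[OF x(1)] torsion_pow_idem(3,4)[OF x(2)]
      by (simp_all add: pow_mult_distrib m_comm)
  qed
  have sub: "subgroup (A <#> B) G" by (rule mult_subgroups[OF AG])
  have "A <#> B = powers G (a \<otimes> b)"
  proof
    show "powers G (a \<otimes> b) \<subseteq> A <#> B"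
      by (rule powers_minimal[OF sub]) (use ab in \<open>auto simp: set_mult_def\<close>)
    show "A <#> B \<subseteq> powers G (a \<otimes> b)"
    proof
      fix z assume "z \<in> A <#> B"
      then obtain i j :: nat where z: "z = a [^] i \<otimes> b [^] j"
        unfolding a b set_mult_def powers_def by auto
      have c: "a \<otimes> b \<in> carrier G" using a b by simp
      have "z = ((a \<otimes> b) [^] e) [^] i \<otimes> ((a \<otimes> b) [^] f) [^] j"
        using pe[OF ab] z by simp
      also have "\<dots> = (a \<otimes> b) [^] (e * i + f * j)"
        using c by (simp add: nat_pow_pow nat_pow_mult)
      finally show "z \<in> powers G (a \<otimes> b)" by (auto simp: powers_def)
    qed
  qed
  then show "cyclic_subgroup (A <#> B) G" using cyclic_subgroup_powers[OF fin] a b by simp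
  show "(A <#> B) \<inter> torsion G m = A"
  proof
    show "(A <#> B) \<inter> torsion G m \<subseteq> A"
    proof
      fix z assume z: "z \<in> (A <#> B) \<inter> torsion G m"
      then obtain x y where xy: "x \<in> A" "y \<in> B" "z = x \<otimes> y" by (auto simp: set_mult_def)
      then show "z \<in> A" using pe(1)[OF xy(1,2)] torsion_pow_idem(1)[of z] z by simp
    qed
    have "x \<in> A <#> B" if "x \<in> A" for x
      using that one(2) carr[of x] unfolding set_mult_def by force
    then show "A \<subseteq> (A <#> B) \<inter> torsion G m" using A(2) by blast
  qed
qed

end

end

text \<open>Intersecting with the two torsion parts and multiplying subgroups are mutually inverse,
  inclusion-preserving maps between the cyclic subgroups of the \<open>m * n\<close>-torsion and
  pairs of cyclic subgroups of the parts. So maximal ones correspond to pairs of maximal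
  ones.\<close>

lemma (in comm_group) num_maximal_cyclic_torsion_mult:
  assumes fin: "finite (carrier G)" and "coprime m n"
  shows "num_maximal_cyclic (G\<lparr>carrier := torsion G (m * n)\<rparr>) =
    num_maximal_cyclic (G\<lparr>carrier := torsion G m\<rparr>) * num_maximal_cyclic (G\<lparr>carrier := torsion G n\<rparr>)"
proof -
  obtain e where e: "[e = 1] (mod m)" "[e = 0] (mod n)"
    using binary_chinese_remainder_nat[OF assms(2)] by blast
  obtain f where f: "[f = 0] (mod m)" "[f = 1] (mod n)"
    using binary_chinese_remainder_nat[OF assms(2)] by blast
  define cyc where "cyc k = {C. cyclic_subgroup C G \<and> C \<subseteq> torsion G k}" for k
  define mc where "mc k = {C \<in> cyc k. \<forall>D\<in>cyc k. C \<subseteq> D \<longrightarrow> C = D}" for k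
  have num: "num_maximal_cyclic (G\<lparr>carrier := torsion G k\<rparr>) = card (mc k)" for k
    unfolding num_maximal_cyclic_def maximal_cyclic_subgroup_restrict[OF is_group subgroup_torsion]
      mc_def cyc_def
    by (rule arg_cong[of _ _ card]) blast
  have mc_eq: "C = D" if "C \<in> mc k" "D \<in> cyc k" "C \<subseteq> D" for C D k
    using that unfolding mc_def by blast
  have mc_cyc: "C \<in> cyc k" if "C \<in> mc k" for C k
    using that unfolding mc_def by blast
  have split: "C \<inter> torsion G m \<in> cyc m" "C \<inter> torsion G n \<in> cyc n"
    "(C \<inter> torsion G m) <#> (C \<inter> torsion G n) = C" if "C \<in> cyc (m * n)" for C
  proof -
    have C: "cyclic_subgroup C G" "C \<subseteq> torsion G (m * n)" "subgroup C G"
      using that by (auto simp: cyc_def cyclic_subgroup_def)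
    show "C \<inter> torsion G m \<in> cyc m"
      using cyclic_subgroup_Int_torsion[OF fin e f C(1,2)] by (auto simp: cyc_def)
    \<comment> \<open>The same fact with the roles of \<open>m\<close>, \<open>e\<close> and
      \<open>n\<close>, \<open>f\<close> exchanged.\<close>
    show "C \<inter> torsion G n \<in> cyc n"
      using cyclic_subgroup_Int_torsion[OF fin f(2,1) e(2,1) C(1)] C(2)
      by (auto simp: cyc_def mult.commute)
    show "(C \<inter> torsion G m) <#> (C \<inter> torsion G n) = C"
    proof
      show "(C \<inter> torsion G m) <#> (C \<inter> torsion G n) \<subseteq> C"
        unfolding set_mult_def using subgroup.m_closed[OF C(3)] by blast
      show "C \<subseteq> (C \<inter> torsion G m) <#> (C \<inter> torsion G n)"
      proof
        fix x assume x: "x \<in> C"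
        then have "x \<in> torsion G (m * n)" using C(2) by blast
        note d = torsion_decompose[OF fin e f this]
        have "x [^] e \<in> C \<inter> torsion G m" "x [^] f \<in> C \<inter> torsion G n"
          using d subgroup_nat_pow_closed[OF C(3) x] by simp_all
        then show "x \<in> (C \<inter> torsion G m) <#> (C \<inter> torsion G n)"
          using d(3) unfolding set_mult_def by blast
      qed
    qed
  qed
  have join: "A <#> B \<in> cyc (m * n)" "(A <#> B) \<inter> torsion G m = A" "(A <#> B) \<inter> torsion G n = B"
    if "A \<in> cyc m" "B \<in> cyc n" for A B
  proof -
    have A: "cyclic_subgroup A G" "A \<subseteq> torsion G m" and B: "cyclic_subgroup B G" "B \<subseteq> torsion G n"
      using that by (auto simp: cyc_def)
    have sub: "A \<subseteq> carrier G" "B \<subseteq> carrier G"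
      using A B by (auto simp: torsion_def)
    note AB = cyclic_subgroup_set_mult[OF fin e f A B]
    have "A <#> B \<subseteq> torsion G (m * n)"
    proof
      fix z assume "z \<in> A <#> B"
      then obtain x y where xy: "x \<in> A" "y \<in> B" "z = x \<otimes> y" by (auto simp: set_mult_def)
      moreover have "x \<in> torsion G (m * n)" "y \<in> torsion G (m * n)"
        using xy A(2) B(2) torsion_mono[of m "m * n"] torsion_mono[of n "m * n"] by auto
      ultimately show "z \<in> torsion G (m * n)"
        using subgroup.m_closed[OF subgroup_torsion] by simp
    qed
    then show "A <#> B \<in> cyc (m * n)" using AB(1) by (simp add: cyc_def)
    show "(A <#> B) \<inter> torsion G m = A" by (rule AB(2))
    have "A <#> B = B <#> A"
      using sub m_comm unfolding set_mult_def by blast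
    then show "(A <#> B) \<inter> torsion G n = B"
      using cyclic_subgroup_set_mult(2)[OF fin f(2,1) e(2,1) B A] by simp
  qed
  define \<phi> where "\<phi> C = (C \<inter> torsion G m, C \<inter> torsion G n)" for C
  define \<psi> where "\<psi> p = fst p <#> snd p" for p
  have "bij_betw \<phi> (mc (m * n)) (mc m \<times> mc n)"
  proof (rule bij_betw_byWitness[of _ \<psi>])
    show "\<forall>C\<in>mc (m * n). \<psi> (\<phi> C) = C"
      using split(3) mc_cyc by (simp add: \<phi>_def \<psi>_def)
    show "\<forall>p\<in>mc m \<times> mc n. \<phi> (\<psi> p) = p"
      using join(2,3) mc_cyc by (auto simp: \<phi>_def \<psi>_def)
    show "\<phi> ` mc (m * n) \<subseteq> mc m \<times> mc n"
    proof (intro subsetI, elim imageE, hypsubst)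
      fix C assume C: "C \<in> mc (m * n)"
      note c = split[OF mc_cyc[OF C]]
      \<comment> \<open>Enlarging one component to \<open>A\<close> gives a cyclic subgroup
        containing \<open>C\<close>. By maximality it is \<open>C\<close>, and intersecting with the
        \<open>m\<close>-torsion recovers \<open>A\<close>.\<close>
      have "C \<inter> torsion G m = A" if A: "A \<in> cyc m" "C \<inter> torsion G m \<subseteq> A" for A
      proof -
        have "C \<subseteq> A <#> (C \<inter> torsion G n)"
          using set_mult_mono[OF A(2) subset_refl, of G "C \<inter> torsion G n"] c(3) by simp
        then have "C = A <#> (C \<inter> torsion G n)" using mc_eq[OF C] join(1)[OF A(1) c(2)] by blast
        then show ?thesis using join(2)[OF A(1) c(2)] by simp
      qed
      moreover have "C \<inter> torsion G n = B" if B: "B \<in> cyc n" "C \<inter> torsion G n \<subseteq> B" for B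
      proof -
        have "C \<subseteq> (C \<inter> torsion G m) <#> B"
          using set_mult_mono[OF subset_refl B(2), of G "C \<inter> torsion G m"] c(3) by simp
        then have "C = (C \<inter> torsion G m) <#> B" using mc_eq[OF C] join(1)[OF c(1) B(1)] by blast
        then show ?thesis using join(3)[OF c(1) B(1)] by simp
      qed
      ultimately show "\<phi> C \<in> mc m \<times> mc n"
        using c(1,2) unfolding mc_def \<phi>_def by blast
    qed
    show "\<psi> ` (mc m \<times> mc n) \<subseteq> mc (m * n)"
    proof (intro subsetI, elim imageE SigmaE, hypsubst)
      fix A B assume AB: "A \<in> mc m" "B \<in> mc n"
      note j = join[OF mc_cyc[OF AB(1)] mc_cyc[OF AB(2)]]
      have "A <#> B = D" if D: "D \<in> cyc (m * n)" "A <#> B \<subseteq> D" for D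
      proof -
        have "A \<subseteq> D \<inter> torsion G m" "B \<subseteq> D \<inter> torsion G n" using j(2,3) D(2) by blast+
        then have "A = D \<inter> torsion G m" "B = D \<inter> torsion G n"
          using mc_eq AB split(1,2)[OF D(1)] by blast+
        then show ?thesis using split(3)[OF D(1)] by simp
      qed
      then show "\<psi> (A, B) \<in> mc (m * n)" using j(1) unfolding mc_def \<psi>_def by simp
    qed
  qed
  then show ?thesis unfolding num by (simp add: bij_betw_same_card card_cartesian_product)
qed

lemma (in comm_group) num_maximal_cyclic_torsion_prod:
  assumes fin: "finite (carrier G)" and "finite Q" "\<forall>p\<in>Q. prime (p::nat)"
  shows "num_maximal_cyclic (G\<lparr>carrier := torsion G (\<Prod>p\<in>Q. p ^ k p)\<rparr>) =
    (\<Prod>p\<in>Q. num_maximal_cyclic (G\<lparr>carrier := torsion G (p ^ k p)\<rparr>))"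
  using assms(2,3)
proof (induction Q rule: finite_induct)
  case empty
  \<comment> \<open>The empty product leaves the trivial group, which has exactly one maximal cyclic
    subgroup, namely itself.\<close>
  have "torsion G 1 = {\<one>}" by (auto simp: torsion_def)
  moreover have "cyclic_subgroup {\<one>} G"
    using cyclic_subgroup_powers[OF fin one_closed] by (simp add: powers_def)
  moreover have "\<one> \<in> C" if "cyclic_subgroup C G" for C
    using that by (auto simp: cyclic_subgroup_def subgroup.one_closed)
  ultimately have "{C. maximal_cyclic_subgroup C (G\<lparr>carrier := torsion G 1\<rparr>)} = {{\<one>}}"
    unfolding maximal_cyclic_subgroup_restrict[OF is_group subgroup_torsion] by fastforce
  then show ?case by (simp add: num_maximal_cyclic_def)
next
  case (insert p Q)
  have "coprime (p ^ k p) (\<Prod>q\<in>Q. q ^ k q)"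
    using insert by (intro prod_coprime_right) (auto intro!: primes_coprime)
  then show ?case
    using insert by (simp add: num_maximal_cyclic_torsion_mult[OF fin])
qed

section \<open>Sylow subgroups as torsion subgroups\<close>

lemma (in comm_group) sylow_subgroup_eq_torsion:
  assumes fin: "finite (carrier G)" and P: "sylow_subgroup p P G"
  shows "P = torsion G (p ^ multiplicity p (order G))"
proof
  let ?n = "p ^ multiplicity p (order G)"
  have p: "prime p" and sub: "subgroup P G" and card: "card P = ?n"
    using P by (auto simp: sylow_subgroup_def)
  interpret P: group "G\<lparr>carrier := P\<rparr>" by (rule subgroup_imp_group[OF sub])
  show "P \<subseteq> torsion G ?n"
  proof
    fix x assume x: "x \<in> P"
    then have "x [^]\<^bsub>G\<lparr>carrier := P\<rparr>\<^esub> card P = \<one>"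
      using P.pow_order_eq_1[of x] by (simp add: order_def)
    then show "x \<in> torsion G ?n"
      using x subgroup.mem_carrier[OF sub] by (simp add: torsion_def card flip: nat_pow_consistent)
  qed
  have ord: "order G > 0" using fin by (simp add: order_gt_0_iff_finite)
  \<comment> \<open>\<open>m\<close> is the order of the quotient by \<open>P\<close>. It is prime
    to \<open>p\<close> because \<open>P\<close> already takes the full power of \<open>p\<close> in
    the order of \<open>G\<close>.\<close>
  define m where "m = card (rcosets P)"
  have m: "m * ?n = order G" using lagrange[OF sub] by (simp add: m_def card)
  have "\<not> p dvd m"
  proof
    assume "p dvd m"
    then have "p * ?n dvd m * ?n" by (rule mult_dvd_mono) simp
    then have "p ^ Suc (multiplicity p (order G)) dvd order G" by (simp only: m power_Suc)
    moreover have "order G \<noteq> 0" "\<not> is_unit p" using ord p by auto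
    ultimately have "Suc (multiplicity p (order G)) \<le> multiplicity p (order G)"
      by (intro multiplicity_geI)
    then show False by simp
  qed
  then have "coprime m ?n" using prime_imp_coprime[OF p, of m] by (simp add: coprime_commute)
  \<comment> \<open>As a multiple of the index, \<open>f\<close> kills the quotient, so every
    \<open>f\<close>-th power lies in \<open>P\<close>. As \<open>f\<close> is 1 modulo
    \<open>?n\<close>, each element of the \<open>?n\<close>-torsion is its own \<open>f\<close>-th
    power.\<close>
  then obtain f where f: "[f = 0] (mod m)" "[f = 1] (mod ?n)"
    using binary_chinese_remainder_nat by blast
  interpret N: normal P G using sub by (rule subgroup_imp_normal)
  interpret Q: group "G Mod P" by (rule N.factorgroup_is_group)
  show "torsion G ?n \<subseteq> P"
  proof
    fix x assume x: "x \<in> torsion G ?n"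
    then have xG: "x \<in> carrier G" by (simp add: torsion_def)
    have rc: "P #> x \<in> carrier (G Mod P)" using xG by (auto simp: FactGroup_def RCOSETS_def)
    have "(P #> x) [^]\<^bsub>G Mod P\<^esub> f = \<one>\<^bsub>G Mod P\<^esub>"
    proof -
      have "order (G Mod P) dvd f" using f(1) by (simp add: order_def FactGroup_def m_def cong_0_iff)
      then show ?thesis using Q.ord_dvd_group_order[OF rc] Q.pow_eq_id[OF rc] dvd_trans by blast
    qed
    moreover have "(P #> x) [^]\<^bsub>G Mod P\<^esub> f = P #> (x [^] f)"
      using hom_nat_pow[OF N.r_coset_hom_Mod xG is_group Q.is_group] by simp
    moreover have "x [^] f = x" using pow_cong_torsion[OF x f(2)] xG by simp
    ultimately have "P #> x = P" by simp
    then show "x \<in> P" using coset_join1[OF _ xG sub] subgroup.subset[OF sub] by simp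
  qed
qed

lemma (in comm_group) num_maximal_cyclic_sylow:
  assumes fin: "finite (carrier G)"
    and P: "\<And>p. p \<in> prime_factors (order G) \<Longrightarrow> sylow_subgroup p (P p) G"
  shows "num_maximal_cyclic G = (\<Prod>p\<in>prime_factors (order G). num_maximal_cyclic (G\<lparr>carrier := P p\<rparr>))"
proof -
  let ?k = "\<lambda>p. multiplicity p (order G)"
  have "order G > 0" using fin by (simp add: order_gt_0_iff_finite)
  then have "order G = (\<Prod>p\<in>prime_factors (order G). p ^ ?k p)"
    using prod_prime_factors[of "order G"] by simp
  moreover have "torsion G (order G) = carrier G"
    using pow_order_eq_1 by (auto simp: torsion_def)
  ultimately have "num_maximal_cyclic G =
    num_maximal_cyclic (G\<lparr>carrier := torsion G (\<Prod>p\<in>prime_factors (order G). p ^ ?k p)\<rparr>)"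
    by simp
  also have "\<dots> = (\<Prod>p\<in>prime_factors (order G). num_maximal_cyclic (G\<lparr>carrier := torsion G (p ^ ?k p)\<rparr>))"
    by (rule num_maximal_cyclic_torsion_prod[OF fin]) auto
  also have "\<dots> = (\<Prod>p\<in>prime_factors (order G). num_maximal_cyclic (G\<lparr>carrier := P p\<rparr>))"
    by (rule prod.cong) (simp_all add: sylow_subgroup_eq_torsion[OF fin P])
  finally show ?thesis .
qed

section \<open>Counting maximal cyclic subgroups by their generators\<close>

lemma (in group) card_powers:
  assumes "finite (carrier G)" "x \<in> carrier G"
  shows "card (powers G x) = ord x"
  using assms by (simp add: powers_eq_generate generate_pow_card)

text \<open>One inclusion always holds, so by finiteness equality of the two sets means equality of
  orders, and \<open>x [^] k\<close> has order \<open>ord x div gcd (ord x) k\<close> for nonzero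
  \<open>k\<close>.\<close>

lemma (in group) powers_pow_eq_iff:
  fixes k :: nat
  assumes fin: "finite (carrier G)" and x: "x \<in> carrier G"
  shows "powers G (x [^] k) = powers G x \<longleftrightarrow> coprime k (ord x)"
proof -
  have n: "ord x > 0" using ord_ge_1[OF fin x] by simp
  have sub: "powers G (x [^] k) \<subseteq> powers G x"
    by (rule powers_minimal[OF subgroup_powers[OF fin x]]) (simp add: powers_def)
  have "finite (powers G x)"
    using subgroup.subset[OF subgroup_powers[OF fin x]] fin by (rule finite_subset)
  note eqI = card_subset_eq[OF this sub]
  have "powers G (x [^] k) = powers G x \<longleftrightarrow> card (powers G (x [^] k)) = card (powers G x)"
    by (rule iffI[OF arg_cong eqI])
  also have "\<dots> \<longleftrightarrow> ord (x [^] k) = ord x"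
    using card_powers[OF fin] x by simp
  also have "\<dots> \<longleftrightarrow> coprime k (ord x)"
  proof (cases "k = 0")
    case True
    then show ?thesis using x by auto
  next
    case False
    have "ord x div gcd (ord x) k = ord x \<longleftrightarrow> gcd (ord x) k = 1"
      using n by (rule div_eq_dividend_iff)
    then show ?thesis
      using False x by (simp add: ord_pow_gen coprime_iff_gcd_eq_1 gcd.commute)
  qed
  finally show ?thesis .
qed

lemma (in group) card_generators:
  assumes fin: "finite (carrier G)" and x: "x \<in> carrier G"
  shows "card {y \<in> carrier G. powers G y = powers G x} = totient (ord x)"
proof -
  have n: "ord x > 0" using ord_ge_1[OF fin x] by simp
  have "{y \<in> carrier G. powers G y = powers G x} = (\<lambda>k. x [^] k) ` totatives (ord x)"
  proof
    show "(\<lambda>k. x [^] k) ` totatives (ord x) \<subseteq> {y \<in> carrier G. powers G y = powers G x}"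
      using x powers_pow_eq_iff[OF fin x] by (auto simp: totatives_def)
    show "{y \<in> carrier G. powers G y = powers G x} \<subseteq> (\<lambda>k. x [^] k) ` totatives (ord x)"
    proof
      fix y assume "y \<in> {y \<in> carrier G. powers G y = powers G x}"
      then have y: "y \<in> carrier G" "powers G y = powers G x" by simp_all
      have "y \<in> powers G x" using powers_self[OF y(1)] by (simp only: y(2))
      then obtain j :: nat where j: "y = x [^] j" by (auto simp: powers_def)
      \<comment> \<open>\<open>totatives n\<close> lies in \<open>{0<..n}\<close>, so the residue 0
        has to be represented by \<open>ord x\<close> instead of 0.\<close>
      define k where "k = (if ord x dvd j then ord x else j mod ord x)"
      have jk: "[j = k] (mod (ord x))" by (auto simp: k_def cong_def)
      moreover have "x \<in> torsion G (ord x)" using x by (simp add: torsion_def)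
      ultimately have yk: "y = x [^] k" unfolding j by (rule pow_cong_torsion[rotated])
      have "k \<in> {0<..ord x}" using n by (auto simp: k_def dvd_eq_mod_eq_0)
      moreover have "coprime k (ord x)"
        using y(2) powers_pow_eq_iff[OF fin x, of k] by (simp only: yk)
      ultimately show "y \<in> (\<lambda>k. x [^] k) ` totatives (ord x)"
        unfolding yk by (intro imageI) (simp add: totatives_def)
    qed
  qed
  moreover have "inj_on (\<lambda>k. x [^] k) (totatives (ord x))"
    by (rule inj_on_subset[OF ord_inj'[OF x]]) (auto simp: totatives_def)
  ultimately show ?thesis by (simp add: card_image totient_def)
qed

section \<open>Maximal cyclic subgroups of a finite abelian p-group\<close>

context comm_group
begin

text \<open>\<open>p ^ A\<close> is any multiple of the exponent of the group. The trivial group is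
  excluded: its only cyclic subgroup is maximal although the generator is a \<open>p\<close>-th
  power.\<close>

context
  fixes p A :: nat
  assumes fin: "finite (carrier G)" and p: "prime p"
    and exponent: "torsion G (p ^ A) = carrier G"
    and nontrivial: "carrier G \<noteq> {\<one>}"
begin

lemma ord_prime_power:
  assumes "x \<in> carrier G"
  shows "\<exists>b\<le>A. ord x = p ^ b"
proof -
  have "x \<in> torsion G (p ^ A)" by (simp add: exponent assms)
  then have "ord x dvd p ^ A" using assms by (simp add: torsion_def pow_eq_id)
  then show ?thesis using p by (simp add: divides_primepow_nat)
qed

lemma pow_generator:
  assumes "x \<in> carrier G" "\<not> p dvd k"
  shows "powers G (x [^] k) = powers G x"
proof -
  obtain b where "ord x = p ^ b" using ord_prime_power[OF assms(1)] by blast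
  moreover have "coprime p k" using assms(2) p by (simp add: prime_imp_coprime)
  ultimately have "coprime k (ord x)" by (simp add: coprime_commute)
  then show ?thesis using powers_pow_eq_iff[OF fin assms(1)] by simp
qed

text \<open>If \<open>x = y [^] p\<close> generates a maximal cyclic subgroup, then so does
  \<open>y\<close>, with the same subgroup; hence \<open>p\<close> is prime to \<open>ord y\<close>,
  which makes \<open>y\<close> and \<open>x\<close> trivial, against nontriviality. Conversely, if
  \<open>x = y [^] k\<close> is not a \<open>p\<close>-th power, then \<open>p\<close> does not
  divide \<open>k\<close> and \<open>x\<close> generates the same subgroup as
  \<open>y\<close>.\<close>

lemma maximal_cyclic_subgroup_powers_iff:
  assumes x: "x \<in> carrier G"
  shows "maximal_cyclic_subgroup (powers G x) G \<longleftrightarrow> x \<notin> (\<lambda>y. y [^] p) ` carrier G"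
proof
  assume max: "maximal_cyclic_subgroup (powers G x) G"
  show "x \<notin> (\<lambda>y. y [^] p) ` carrier G"
  proof
    assume "x \<in> (\<lambda>y. y [^] p) ` carrier G"
    then obtain y where y: "y \<in> carrier G" "x = y [^] p" by blast
    have "powers G x \<subseteq> powers G y"
      unfolding y(2) by (rule powers_minimal[OF subgroup_powers[OF fin y(1)]]) (simp add: powers_def)
    then have "powers G (y [^] p) = powers G y"
      using maximal_cyclic_subgroup_eq[OF max cyclic_subgroup_powers[OF fin y(1)]] y(2) by simp
    then have "coprime p (ord y)" using powers_pow_eq_iff[OF fin y(1)] by simp
    moreover obtain b where b: "ord y = p ^ b" using ord_prime_power[OF y(1)] by blast
    ultimately have "ord y = 1" using p by (cases b) auto
    then have "x = \<one>" using y ord_eq_1[OF y(1)] by simp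
    then have 1: "powers G x = {\<one>}" by (auto simp: powers_def)
    obtain z where z: "z \<in> carrier G" "z \<noteq> \<one>" using nontrivial one_closed by blast
    have "powers G x \<subseteq> powers G z"
      using 1 subgroup.one_closed[OF subgroup_powers[OF fin z(1)]] by simp
    then have "powers G x = powers G z"
      using maximal_cyclic_subgroup_eq[OF max cyclic_subgroup_powers[OF fin z(1)]] by simp
    then have "z \<in> {\<one>}" using powers_self[OF z(1)] by (simp only: 1)
    then show False using z(2) by simp
  qed
next
  assume notin: "x \<notin> (\<lambda>y. y [^] p) ` carrier G"
  have "powers G x = D" if "cyclic_subgroup D G" "powers G x \<subseteq> D" for D
  proof -
    obtain y where y: "y \<in> carrier G" "D = powers G y"
      using \<open>cyclic_subgroup D G\<close> cyclic_subgroup_iff[OF fin] by blast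
    have "x \<in> powers G y" using that(2) powers_self[OF x] y(2) by blast
    then obtain k :: nat where k: "x = y [^] k" by (auto simp: powers_def)
    have "\<not> p dvd k"
    proof
      assume "p dvd k"
      then obtain j where "k = p * j" by (elim dvdE)
      then have "x = (y [^] j) [^] p" using y(1) by (simp add: k nat_pow_pow mult.commute)
      then show False using notin y(1) by blast
    qed
    then show ?thesis using pow_generator[OF y(1)] k y(2) by simp
  qed
  then show "maximal_cyclic_subgroup (powers G x) G"
    unfolding maximal_cyclic_subgroup_def using cyclic_subgroup_powers[OF fin x] by blast
qed

text \<open>Each maximal cyclic subgroup is counted through its generators, all of the same order,
  with total weight 1.\<close>

lemma num_maximal_cyclic_eq_sum_generators:
  "real (num_maximal_cyclic G) =
     (\<Sum>x \<in> carrier G - (\<lambda>y. y [^] p) ` carrier G. 1 / real (totient (ord x)))"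
proof -
  let ?X = "carrier G - (\<lambda>y. y [^] p) ` carrier G"
  have max_image: "{C. maximal_cyclic_subgroup C G} = powers G ` ?X"
  proof
    show "powers G ` ?X \<subseteq> {C. maximal_cyclic_subgroup C G}"
      using maximal_cyclic_subgroup_powers_iff by blast
    show "{C. maximal_cyclic_subgroup C G} \<subseteq> powers G ` ?X"
    proof
      fix C assume "C \<in> {C. maximal_cyclic_subgroup C G}"
      then have C: "maximal_cyclic_subgroup C G" by simp
      then obtain x where x: "x \<in> carrier G" "C = powers G x"
        using cyclic_subgroup_iff[OF fin] maximal_cyclic_subgroupD by blast
      then show "C \<in> powers G ` ?X" using C maximal_cyclic_subgroup_powers_iff[OF x(1)] by blast
    qed
  qed
  have "(\<Sum>x\<in>?X. 1 / real (totient (ord x))) =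
    (\<Sum>C\<in>powers G ` ?X. \<Sum>x | x \<in> ?X \<and> powers G x = C. 1 / real (totient (ord x)))"
    by (rule sum.image_gen) (simp add: fin)
  also have "\<dots> = (\<Sum>C\<in>powers G ` ?X. 1)"
  proof (rule sum.cong[OF refl])
    fix C assume "C \<in> powers G ` ?X"
    then obtain x where x: "x \<in> ?X" "C = powers G x" by blast
    then have xG: "x \<in> carrier G" by blast
    \<comment> \<open>Lying outside the \<open>p\<close>-th powers depends only on the subgroup
      generated, so \<open>?X\<close> contains all generators of \<open>C\<close>.\<close>
    have fiber: "{y. y \<in> ?X \<and> powers G y = C} = {y \<in> carrier G. powers G y = powers G x}"
      unfolding x(2) using maximal_cyclic_subgroup_powers_iff x(1) by (metis (no_types, lifting) Diff_iff)
    have "(\<Sum>y | y \<in> ?X \<and> powers G y = C. 1 / real (totient (ord y))) =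
      (\<Sum>y | y \<in> ?X \<and> powers G y = C. 1 / real (totient (ord x)))"
      using card_powers[OF fin] xG x(2) by (intro sum.cong) (auto simp flip: card_powers[OF fin])
    also have "\<dots> = real (card {y \<in> carrier G. powers G y = powers G x}) / real (totient (ord x))"
      unfolding fiber by simp
    also have "\<dots> = 1"
      using ord_ge_1[OF fin xG] by (simp add: card_generators[OF fin xG] totient_gt_0_iff)
    finally show "(\<Sum>y | y \<in> ?X \<and> powers G y = C. 1 / real (totient (ord y))) = 1" .
  qed
  finally show ?thesis by (simp add: num_maximal_cyclic_def max_image)
qed

text \<open>The generators are grouped by order: \<open>D b - D (b - 1)\<close> counts those of
  order exactly \<open>p ^ b\<close>, and the denominator is the totient of
  \<open>p ^ b\<close>.\<close>

lemma num_maximal_cyclic_eq_sum_orders: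
  defines "D \<equiv> \<lambda>b. real (card (torsion G (p ^ b) - (\<lambda>y. y [^] p) ` carrier G))"
  shows "real (num_maximal_cyclic G) =
     (\<Sum>b=1..A. (D b - D (b - 1)) / real (p ^ (b - 1) * (p - 1)))"
proof -
  let ?X = "carrier G - (\<lambda>y. y [^] p) ` carrier G"
  define X where "X b = {x \<in> ?X. ord x = p ^ b}" for b
  have inj: "p ^ b = p ^ c \<longleftrightarrow> b = c" for b c
    using prime_gt_1_nat[OF p] by (rule power_inject_exp)
  have dvd: "p ^ b dvd p ^ c \<longleftrightarrow> b \<le> c" for b c
    using power_dvd_imp_le[OF _ prime_gt_1_nat[OF p]] le_imp_power_dvd by blast
  \<comment> \<open>The identity is a \<open>p\<close>-th power, so the sum starts at
    \<open>b = 1\<close>.\<close>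
  have ord1: "ord x \<noteq> 1" if "x \<in> ?X" for x
  proof
    assume "ord x = 1"
    then have "x = \<one> [^] p" using that ord_eq_1 by simp
    then show False using that one_closed by blast
  qed
  have X_Un: "?X = (\<Union>b\<in>{1..A}. X b)"
  proof
    show "(\<Union>b\<in>{1..A}. X b) \<subseteq> ?X" by (auto simp: X_def)
    show "?X \<subseteq> (\<Union>b\<in>{1..A}. X b)"
    proof
      fix x assume x: "x \<in> ?X"
      then obtain b where b: "b \<le> A" "ord x = p ^ b" using ord_prime_power by blast
      with ord1[OF x] have "b \<in> {1..A}" by (cases b) auto
      then show "x \<in> (\<Union>b\<in>{1..A}. X b)" using x b(2) by (auto simp: X_def)
    qed
  qed
  have cardX: "real (card (X b)) = D b - D (b - 1)" if "b \<in> {1..A}" for b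
  proof -
    have "X b = (torsion G (p ^ b) - (\<lambda>y. y [^] p) ` carrier G) -
      (torsion G (p ^ (b - 1)) - (\<lambda>y. y [^] p) ` carrier G)" (is "_ = ?S - ?T")
    proof -
      have "ord x = p ^ b \<longleftrightarrow> ord x dvd p ^ b \<and> \<not> ord x dvd p ^ (b - 1)" if xG: "x \<in> carrier G" for x
      proof -
        obtain c where c: "ord x = p ^ c" using ord_prime_power[OF xG] by blast
        show ?thesis
          using \<open>b \<in> {1..A}\<close> unfolding c inj dvd by auto
      qed
      then show ?thesis by (auto simp: X_def torsion_def pow_eq_id)
    qed
    moreover have "?T \<subseteq> ?S" using torsion_mono[of "p ^ (b - 1)" "p ^ b"] by (auto simp: le_imp_power_dvd)
    moreover have "finite ?S" "finite ?T" using fin by (auto simp: torsion_def)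
    ultimately show ?thesis unfolding D_def by (simp add: card_Diff_subset card_mono of_nat_diff)
  qed
  have "real (num_maximal_cyclic G) = (\<Sum>x\<in>?X. 1 / real (totient (ord x)))"
    by (rule num_maximal_cyclic_eq_sum_generators)
  also have "\<dots> = (\<Sum>b=1..A. \<Sum>x\<in>X b. 1 / real (totient (ord x)))"
    unfolding X_Un by (rule sum.UNION_disjoint) (auto simp: X_def inj fin)
  also have "\<dots> = (\<Sum>b=1..A. (D b - D (b - 1)) / real (p ^ (b - 1) * (p - 1)))"
  proof (rule sum.cong[OF refl])
    fix b assume b: "b \<in> {1..A}"
    have "(\<Sum>x\<in>X b. 1 / real (totient (ord x))) = (\<Sum>x\<in>X b. 1 / real (p ^ (b - 1) * (p - 1)))"
      using b p by (intro sum.cong) (auto simp: X_def totient_prime_power)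
    then show "(\<Sum>x\<in>X b. 1 / real (totient (ord x))) = (D b - D (b - 1)) / real (p ^ (b - 1) * (p - 1))"
      by (simp add: cardX[OF b])
  qed
  finally show ?thesis .
qed

end

end

section \<open>Torsion in products of cyclic groups\<close>

text \<open>One notion serves both counts: \<open>q = 1\<close> gives all elements killed by
  \<open>k\<close>, and \<open>q = p\<close> gives the \<open>p\<close>-th powers among
  them.\<close>

definition power_torsion :: "('a, 'b) monoid_scheme \<Rightarrow> nat \<Rightarrow> nat \<Rightarrow> 'a set" where
  "power_torsion G q k = {y \<in> (\<lambda>x. x [^]\<^bsub>G\<^esub> q) ` carrier G. y [^]\<^bsub>G\<^esub> k = \<one>\<^bsub>G\<^esub>}"

lemma card_power_torsion_iso:
  assumes "G \<cong> H" "group G" "group H"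
  shows "card (power_torsion G q k) = card (power_torsion H q k)"
proof -
  obtain h where h: "h \<in> iso G H" using assms(1) by (auto simp: is_iso_def)
  then have hom: "h \<in> hom G H" and bij: "bij_betw h (carrier G) (carrier H)"
    by (auto simp: iso_def)
  interpret group_hom G H h using assms hom by (simp add: group_hom_def group_hom_axioms_def)
  have inj: "inj_on h (carrier G)" and surj: "h ` carrier G = carrier H"
    using bij by (auto simp: bij_betw_def)
  have one: "h y = \<one>\<^bsub>H\<^esub> \<longleftrightarrow> y = \<one>\<^bsub>G\<^esub>" if "y \<in> carrier G" for y
    using inj_on_eq_iff[OF inj that G.one_closed] by simp
  have "h ` power_torsion G q k = power_torsion H q k"
  proof
    show "h ` power_torsion G q k \<subseteq> power_torsion H q k"
    proof (intro subsetI, elim imageE, hypsubst)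
      fix y assume "y \<in> power_torsion G q k"
      then obtain x where x: "x \<in> carrier G" "y = x [^]\<^bsub>G\<^esub> q" "y [^]\<^bsub>G\<^esub> k = \<one>\<^bsub>G\<^esub>"
        by (auto simp: power_torsion_def)
      then have "h y = h x [^]\<^bsub>H\<^esub> q" "h y [^]\<^bsub>H\<^esub> k = \<one>\<^bsub>H\<^esub>" "h x \<in> carrier H"
        by (simp_all flip: hom_nat_pow)
      then show "h y \<in> power_torsion H q k" by (auto simp: power_torsion_def)
    qed
    show "power_torsion H q k \<subseteq> h ` power_torsion G q k"
    proof
      fix z assume "z \<in> power_torsion H q k"
      then obtain y where "y \<in> carrier H" "z = y [^]\<^bsub>H\<^esub> q" "z [^]\<^bsub>H\<^esub> k = \<one>\<^bsub>H\<^esub>"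
        by (auto simp: power_torsion_def)
      moreover from \<open>y \<in> carrier H\<close> obtain x where "x \<in> carrier G" "y = h x"
        using surj by blast
      ultimately have "z = h (x [^]\<^bsub>G\<^esub> q)" "x \<in> carrier G" "h ((x [^]\<^bsub>G\<^esub> q) [^]\<^bsub>G\<^esub> k) = \<one>\<^bsub>H\<^esub>"
        by (simp_all add: hom_nat_pow)
      then show "z \<in> h ` power_torsion G q k"
        using one[of "(x [^]\<^bsub>G\<^esub> q) [^]\<^bsub>G\<^esub> k"] by (auto simp: power_torsion_def)
    qed
  qed
  moreover have "inj_on h (power_torsion G q k)"
    by (rule inj_on_subset[OF inj]) (auto simp: power_torsion_def)
  ultimately show ?thesis by (metis card_image)
qed

lemma nat_pow_product_group:
  "x [^]\<^bsub>product_group I G\<^esub> (n::nat) = (\<lambda>i\<in>I. x i [^]\<^bsub>G i\<^esub> n)"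
  by (induct n) (auto simp: nat_pow_def)

lemma power_torsion_product_group:
  "power_torsion (product_group I G) q k = (\<Pi>\<^sub>E i\<in>I. power_torsion (G i) q k)"
proof
  show "power_torsion (product_group I G) q k \<subseteq> (\<Pi>\<^sub>E i\<in>I. power_torsion (G i) q k)"
  proof
    fix y assume "y \<in> power_torsion (product_group I G) q k"
    then obtain x where x: "x \<in> (\<Pi>\<^sub>E i\<in>I. carrier (G i))" and y: "y = (\<lambda>i\<in>I. x i [^]\<^bsub>G i\<^esub> q)"
      and k: "(\<lambda>i\<in>I. y i [^]\<^bsub>G i\<^esub> k) = (\<lambda>i\<in>I. \<one>\<^bsub>G i\<^esub>)"
      unfolding power_torsion_def nat_pow_product_group by auto
    have "y i \<in> power_torsion (G i) q k" if "i \<in> I" for i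
      using x fun_cong[OF k, of i] that PiE_mem[OF x that] unfolding power_torsion_def y by auto
    then show "y \<in> (\<Pi>\<^sub>E i\<in>I. power_torsion (G i) q k)" unfolding y by auto
  qed
  show "(\<Pi>\<^sub>E i\<in>I. power_torsion (G i) q k) \<subseteq> power_torsion (product_group I G) q k"
  proof
    fix y assume y: "y \<in> (\<Pi>\<^sub>E i\<in>I. power_torsion (G i) q k)"
    then have "\<forall>i\<in>I. \<exists>x\<in>carrier (G i). y i = x [^]\<^bsub>G i\<^esub> q"
      by (auto simp: power_torsion_def dest: PiE_mem)
    \<comment> \<open>A \<open>q\<close>-th root is chosen in each component; restricting the family
      to \<open>I\<close> makes it an element of the product.\<close>
    then obtain x where x: "\<forall>i\<in>I. x i \<in> carrier (G i) \<and> y i = x i [^]\<^bsub>G i\<^esub> q"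
      unfolding Bex_def by (rule bchoice[elim_format]) blast
    have "y = restrict x I [^]\<^bsub>product_group I G\<^esub> q"
      unfolding nat_pow_product_group using x PiE_arb[OF y] by (auto simp: fun_eq_iff)
    moreover have "restrict x I \<in> carrier (product_group I G)" using x by simp
    moreover have "y [^]\<^bsub>product_group I G\<^esub> k = \<one>\<^bsub>product_group I G\<^esub>"
      unfolding nat_pow_product_group one_product_group
      using PiE_mem[OF y] by (intro restrict_ext) (simp add: power_torsion_def)
    ultimately show "y \<in> power_torsion (product_group I G) q k"
      unfolding power_torsion_def by blast
  qed
qed

lemma card_power_torsion_integer_mod_group:
  assumes "p > 0" "c \<le> a"
  shows "card (power_torsion (integer_mod_group (p ^ a)) (p ^ c) (p ^ b)) = p ^ min (a - c) b"
proof -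
  \<comment> \<open>The set consists of the multiples of \<open>p ^ d\<close>: being a multiple of
    \<open>p ^ c\<close> and being killed by \<open>p ^ b\<close> mean divisibility by
    \<open>p ^ c\<close> and by \<open>p ^ (a - b)\<close>. For \<open>b > a\<close> the truncated
    difference is 0, as everything is then killed.\<close>
  define d where "d = max c (a - b)"
  have d: "c \<le> d" "d \<le> a" "a \<le> b + d" "a - d = min (a - c) b"
    using assms(2) by (auto simp: d_def)
  let ?P = "int p"
  have pos: "?P ^ e > 0" for e using assms(1) by simp
  have pow: "?P ^ e * ?P ^ (e' - e) = ?P ^ e'" if "e \<le> e'" for e e'
    using that by (simp flip: power_add)
  have "power_torsion (integer_mod_group (p ^ a)) (p ^ c) (p ^ b) =
    (\<lambda>j. ?P ^ d * j) ` {0..<?P ^ (a - d)}"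
  proof
    show "power_torsion (integer_mod_group (p ^ a)) (p ^ c) (p ^ b) \<subseteq> (\<lambda>j. ?P ^ d * j) ` {0..<?P ^ (a - d)}"
    proof
      fix y assume "y \<in> power_torsion (integer_mod_group (p ^ a)) (p ^ c) (p ^ b)"
      then obtain x where y: "y = ?P ^ c * x mod ?P ^ a" and k: "?P ^ b * y mod ?P ^ a = 0"
        by (auto simp: power_torsion_def)
      have yr: "0 \<le> y" "y < ?P ^ a" using pos unfolding y by simp_all
      have "?P ^ c dvd y" unfolding y using assms(2) by (simp add: dvd_mod le_imp_power_dvd)
      moreover have "?P ^ (a - b) dvd y"
      proof (cases "b \<le> a")
        case True
        have "?P ^ b * ?P ^ (a - b) dvd ?P ^ b * y" using k True by (simp add: pow mod_eq_0_iff_dvd)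
        then show ?thesis using assms(1) by simp
      qed simp
      ultimately have "?P ^ d dvd y" by (simp add: d_def max_def)
      then obtain j where j: "y = ?P ^ d * j" by (elim dvdE)
      have "?P ^ d * j < ?P ^ d * ?P ^ (a - d)" using yr(2) d(2) by (simp add: j pow)
      then have "j < ?P ^ (a - d)" using pos by simp
      moreover have "0 \<le> j" using yr(1) pos[of d] by (simp add: j zero_le_mult_iff)
      ultimately show "y \<in> (\<lambda>j. ?P ^ d * j) ` {0..<?P ^ (a - d)}" using j by auto
    qed
    show "(\<lambda>j. ?P ^ d * j) ` {0..<?P ^ (a - d)} \<subseteq> power_torsion (integer_mod_group (p ^ a)) (p ^ c) (p ^ b)"
    proof (intro subsetI, elim imageE, hypsubst)
      fix j assume "j \<in> {0..<?P ^ (a - d)}"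
      then have j: "0 \<le> j" "j < ?P ^ (a - d)" by auto
      have lt: "?P ^ d * j < ?P ^ a"
        using mult_strict_left_mono[OF j(2) pos[of d]] d(2) by (simp add: pow)
      \<comment> \<open>\<open>x\<close> is the required root of \<open>p ^ d * j\<close>. Since
        \<open>x\<close> is at most \<open>p ^ c * x\<close>, which is below \<open>p ^ a\<close>,
        it is a canonical representative.\<close>
      define x where "x = ?P ^ (d - c) * j"
      have x: "?P ^ c * x = ?P ^ d * j" unfolding x_def using d(1) by (simp add: pow flip: mult.assoc)
      have "0 \<le> x" using j(1) by (simp add: x_def)
      moreover have "1 * x \<le> ?P ^ c * x"
        using \<open>0 \<le> x\<close> pos[of c] by (intro mult_right_mono) linarith+
      ultimately have "x \<in> carrier (integer_mod_group (p ^ a))"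
        using lt assms(1) unfolding x by (simp add: carrier_integer_mod_group)
      moreover have "?P ^ d * j = x [^]\<^bsub>integer_mod_group (p ^ a)\<^esub> (p ^ c)"
        using lt j(1) by (simp add: x)
      moreover have "?P ^ a dvd ?P ^ (b + d) * j" using d(3) by (simp add: le_imp_power_dvd)
      then have "(?P ^ d * j) [^]\<^bsub>integer_mod_group (p ^ a)\<^esub> (p ^ b) = 0"
        by (simp add: power_add mult.assoc mod_eq_0_iff_dvd)
      ultimately show "?P ^ d * j \<in> power_torsion (integer_mod_group (p ^ a)) (p ^ c) (p ^ b)"
        unfolding power_torsion_def by auto
    qed
  qed
  moreover have "inj_on (\<lambda>j. ?P ^ d * j) {0..<?P ^ (a - d)}"
    using assms(1) by (auto simp: inj_on_def)
  ultimately show ?thesis by (simp add: card_image nat_power_eq flip: d(4))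
qed

lemma card_power_torsion_abelian_p_group:
  assumes "p > 0" "\<And>i. i \<in> {1..s} \<Longrightarrow> c \<le> \<alpha> i"
  shows "card (power_torsion (abelian_p_group p s \<alpha> m) (p ^ c) (p ^ b)) =
    p ^ (\<Sum>i=1..s. m i * min (\<alpha> i - c) b)"
proof -
  have "card (power_torsion (abelian_p_group p s \<alpha> m) (p ^ c) (p ^ b)) =
    (\<Prod>i=1..s. card (power_torsion (integer_mod_group (p ^ \<alpha> i)) (p ^ c) (p ^ b)) ^ m i)"
    unfolding abelian_p_group_def cyclic_power_def power_torsion_product_group
    by (simp add: card_PiE)
  also have "\<dots> = (\<Prod>i=1..s. p ^ (m i * min (\<alpha> i - c) b))"
    using assms by (intro prod.cong)
      (simp_all add: card_power_torsion_integer_mod_group mult.commute flip: power_mult)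
  finally show ?thesis by (simp add: power_sum)
qed

lemma group_abelian_p_group: "group (abelian_p_group p s \<alpha> m)"
  by (simp add: abelian_p_group_def cyclic_power_def)

section \<open>The closed formula\<close>

text \<open>Abel summation; the final \<open>- D 0\<close> corrects the term at \<open>b = 0\<close>
  of the sum on the right.\<close>

lemma sum_by_parts_power:
  fixes P :: real
  assumes "P > 0"
  shows "(\<Sum>b=1..A. (D b - D (b - 1)) / P ^ b) =
    D A / P ^ A + (1 - 1 / P) * (\<Sum>b<A. D b / P ^ b) - D 0"
proof (induction A)
  case (Suc A)
  have "D A / P ^ A = P * D A / P ^ Suc A" using assms by simp
  then show ?case using Suc assms by (simp add: field_simps)
qed simp

lemma geometric_sum_diff:
  fixes P :: real
  assumes "P > 0" "a \<le> b"
  shows "(\<Sum>t\<in>{a..<b}. 1 / P ^ t) * (1 - 1 / P) = 1 / P ^ a - 1 / P ^ b"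
  using assms(2)
proof (induction b rule: dec_induct)
  case (step b)
  have "1 / P ^ b * (1 - 1 / P) = 1 / P ^ b - 1 / P ^ Suc b"
    by (simp add: right_diff_distrib)
  with step show ?case by (simp add: distrib_right)
qed simp

lemma r_sum_mono: "j \<le> k \<Longrightarrow> r_sum m j \<le> r_sum m k"
  unfolding r_sum_def by (rule sum_mono2) auto

lemma block_index_eq:
  assumes "1 \<le> k" "k \<le> s" "r_sum m (k - 1) < t" "t \<le> r_sum m k"
  shows "block_index s m t = k"
  unfolding block_index_def
proof (rule the_equality)
  fix j assume j: "1 \<le> j \<and> j \<le> s \<and> r_sum m (j - 1) < t \<and> t \<le> r_sum m j"
  have "\<not> j < k" using r_sum_mono[of j "k - 1" m] assms j by linarith
  moreover have "\<not> k < j" using r_sum_mono[of k "j - 1" m] assms j by linarith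
  ultimately show "j = k" by simp
qed (use assms in simp)

text \<open>On each block of \<open>t\<close> the index is constant, leaving a geometric sum over
  \<open>t - 1\<close> from \<open>r_sum m (k - 1)\<close> up to, but excluding,
  \<open>r_sum m k\<close>. The factor \<open>1 - 1 / P\<close> makes it telescope.\<close>

lemma sum_block_index:
  fixes P :: real and e :: "nat \<Rightarrow> real"
  assumes P: "P > 0" and "j \<le> s"
  shows "(\<Sum>t=1..r_sum m j. e (block_index s m t) / P ^ (t - 1)) * (1 - 1 / P) =
    (\<Sum>k=1..j. e k * (1 / P ^ r_sum m (k - 1) - 1 / P ^ r_sum m k))"
  using assms(2)
proof (induction j)
  case 0
  then show ?case by (simp add: r_sum_def)
next
  case (Suc j)
  let ?f = "\<lambda>t. e (block_index s m t) / P ^ (t - 1)"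
  have le: "r_sum m j \<le> r_sum m (Suc j)" by (rule r_sum_mono) simp
  have "{1..r_sum m (Suc j)} = {1..r_sum m j} \<union> {Suc (r_sum m j)..r_sum m (Suc j)}"
    using le by auto
  then have "sum ?f {1..r_sum m (Suc j)} =
    sum ?f {1..r_sum m j} + sum ?f {Suc (r_sum m j)..r_sum m (Suc j)}"
    by (simp add: sum.union_disjoint)
  also have "sum ?f {Suc (r_sum m j)..r_sum m (Suc j)} =
    (\<Sum>t\<in>{Suc (r_sum m j)..r_sum m (Suc j)}. e (Suc j) / P ^ (t - 1))"
    using Suc.prems block_index_eq[of "Suc j" s m] by (intro sum.cong) simp_all
  also have "\<dots> = (\<Sum>t\<in>{r_sum m j..<r_sum m (Suc j)}. e (Suc j) * (1 / P ^ t))"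
    by (rule sum.reindex_bij_witness[of _ Suc "\<lambda>t. t - 1"]) auto
  also have "\<dots> = e (Suc j) * (\<Sum>t\<in>{r_sum m j..<r_sum m (Suc j)}. 1 / P ^ t)"
    by (simp only: sum_distrib_left)
  finally show ?case
    using Suc geometric_sum_diff[OF P le]
    by (simp add: distrib_right mult.assoc)
qed

section \<open>The type of an abelian p-group and its closed formula\<close>

locale abelian_p_type =
  fixes p s :: nat and \<alpha> m :: "nat \<Rightarrow> nat"
  assumes p_gt_1: "p > 1" and s_pos: "1 \<le> s"
    and \<alpha>_pos: "i \<in> {1..s} \<Longrightarrow> 0 < \<alpha> i" and m_pos: "i \<in> {1..s} \<Longrightarrow> 0 < m i"
    and \<alpha>_decreasing: "\<lbrakk>i \<in> {1..s}; j \<in> {1..s}; i < j\<rbrakk> \<Longrightarrow> \<alpha> i > \<alpha> j"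
begin

abbreviation P :: real where "P \<equiv> real p"

lemma P_gt_1: "P > 1" using p_gt_1 by simp

lemma p_pos [simp]: "p > 0" "p \<noteq> 0" using p_gt_1 by auto

lemma P_pos: "P > 0" by simp

lemma \<alpha>_antimono: "\<lbrakk>1 \<le> i; i \<le> j; j \<le> s\<rbrakk> \<Longrightarrow> \<alpha> j \<le> \<alpha> i"
  using \<alpha>_decreasing[of i j] by (cases "i = j") auto

text \<open>\<open>p ^ W b\<close> is the order of the subgroup of \<open>p ^ b\<close>-th powers in
  the group of this type.\<close>

definition W :: "nat \<Rightarrow> nat" where "W b = (\<Sum>i=1..s. m i * (\<alpha> i - b))"

text \<open>
  The proportion of the elements killed by \<open>p ^ b\<close>; the subtraction in \<^term>\<open>W\<close> is meant to
  truncate.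
\<close>

definition V :: "nat \<Rightarrow> real" where "V b = 1 / P ^ W b"

lemma V_eq_1: "\<alpha> 1 \<le> b \<Longrightarrow> V b = 1"
proof -
  assume "\<alpha> 1 \<le> b"
  then have "\<alpha> i - b = 0" if "i \<in> {1..s}" for i using \<alpha>_antimono[of 1 i] that by auto
  then show "V b = 1" by (simp add: V_def W_def)
qed

text \<open>For \<open>b\<close> between two consecutive exponents only the first \<open>k\<close>
  blocks contribute to \<open>W b\<close>, without truncation. Both endpoints are allowed, so at an
  exponent the formulas of neighbouring blocks agree.\<close>

lemma n_prod_eq:
  assumes "k \<in> {1..s}" "b \<le> \<alpha> k" "k < s \<Longrightarrow> \<alpha> (k + 1) \<le> b"
  shows "P ^ (r_sum m k * b) / real (n_prod p \<alpha> m k) = V b"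
proof -
  have "W b = (\<Sum>i=1..k. m i * (\<alpha> i - b))"
    unfolding W_def
  proof (rule sum.mono_neutral_right)
    show "\<forall>i\<in>{1..s} - {1..k}. m i * (\<alpha> i - b) = 0"
    proof
      fix i assume "i \<in> {1..s} - {1..k}"
      then have "\<alpha> i \<le> b" using \<alpha>_antimono[of "k + 1" i] assms(3) by auto
      then show "m i * (\<alpha> i - b) = 0" by simp
    qed
  qed (use assms in auto)
  then have "W b + r_sum m k * b = (\<Sum>i=1..k. m i * (\<alpha> i - b) + m i * b)"
    by (simp add: r_sum_def sum.distrib sum_distrib_right)
  also have "\<dots> = (\<Sum>i=1..k. m i * \<alpha> i)"
  proof (rule sum.cong[OF refl])
    fix i assume "i \<in> {1..k}"
    then have "b \<le> \<alpha> i" using \<alpha>_antimono[of i k] assms by auto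
    then show "m i * (\<alpha> i - b) + m i * b = m i * \<alpha> i" by (simp flip: distrib_left)
  qed
  finally have "real (n_prod p \<alpha> m k) = P ^ W b * P ^ (r_sum m k * b)"
    by (simp add: n_prod_def flip: power_add)
  then show ?thesis by (simp add: V_def)
qed

lemma r_sum_pos: "k \<in> {1..s} \<Longrightarrow> 0 < r_sum m k"
  using r_sum_mono[of 1 k m] m_pos[of 1] by (auto simp: r_sum_def)

lemma power_r_sum_minus_1:
  "k \<in> {1..s} \<Longrightarrow> P ^ ((r_sum m k - 1) * b) = P ^ (r_sum m k * b) / P ^ b"
  using r_sum_pos[of k] by (cases "r_sum m k") (simp_all add: power_add)

text \<open>The braces of the closed formula become a tail sum whose summand is the same for all
  blocks; only the lower limit depends on \<open>k\<close>. The induction starts with a geometric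
  sum, as \<open>V\<close> is 1 from \<open>\<alpha> 1\<close> on.\<close>

lemma mu_summand_eq:
  assumes "k \<in> {1..s}" "A \<ge> \<alpha> 1"
  shows "P ^ ((r_sum m k - 1) * \<alpha> k) / real (n_prod p \<alpha> m k) + mu_term p \<alpha> m k =
    1 / P ^ A + (1 - 1 / P) * (\<Sum>\<beta>\<in>{\<alpha> k..<A}. V (\<beta> + 1) / P ^ \<beta>)"
    (is "?lhs k = ?rhs k")
proof -
  have lhs: "?lhs k = V (\<alpha> k) / P ^ \<alpha> k + mu_term p \<alpha> m k" if "k \<in> {1..s}" for k
    using n_prod_eq[OF that, of "\<alpha> k"] that \<alpha>_antimono[of k "k + 1"]
    unfolding power_r_sum_minus_1[OF that] by (simp add: field_simps)
  have "1 \<le> k" using assms(1) by simp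
  then show ?thesis using assms(1)
  proof (induction k rule: dec_induct)
    case base
    have "?rhs 1 = 1 / P ^ A + (\<Sum>\<beta>\<in>{\<alpha> 1..<A}. 1 / P ^ \<beta>) * (1 - 1 / P)"
      by (simp add: V_eq_1 mult.commute)
    also have "\<dots> = V (\<alpha> 1) / P ^ \<alpha> 1"
      using geometric_sum_diff[OF P_pos assms(2)] by (simp add: V_eq_1)
    finally show ?case using base lhs[of 1] by (simp add: mu_term_def)
  next
    case (step k)
    then have k: "k \<in> {1..s}" "Suc k \<in> {1..s}" and IH: "?lhs k = ?rhs k" by auto
    have dec: "\<alpha> (Suc k) < \<alpha> k" using \<alpha>_decreasing[OF k] by simp
    have V: "P ^ (r_sum m k * b) / real (n_prod p \<alpha> m k) = V b"
      if "\<alpha> (Suc k) \<le> b" "b \<le> \<alpha> k" for b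
      using n_prod_eq[OF k(1) that(2)] that(1) by simp
    have "mu_term p \<alpha> m (Suc k) - mu_term p \<alpha> m k =
      (P ^ r_sum m k - 1) / real (n_prod p \<alpha> m k) *
        (\<Sum>\<beta>=\<alpha> (Suc k)..\<alpha> k - 1. P ^ ((r_sum m k - 1) * \<beta>))"
      using k by (cases k) (simp_all add: mu_term_def)
    also have "{\<alpha> (Suc k)..\<alpha> k - 1} = {\<alpha> (Suc k)..<\<alpha> k}" using dec by auto
    also have "(P ^ r_sum m k - 1) / real (n_prod p \<alpha> m k) *
        (\<Sum>\<beta>\<in>{\<alpha> (Suc k)..<\<alpha> k}. P ^ ((r_sum m k - 1) * \<beta>)) =
      (\<Sum>\<beta>\<in>{\<alpha> (Suc k)..<\<alpha> k}. (V (\<beta> + 1) - V \<beta>) / P ^ \<beta>)"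
      unfolding sum_distrib_left
    proof (rule sum.cong[OF refl])
      fix \<beta> assume "\<beta> \<in> {\<alpha> (Suc k)..<\<alpha> k}"
      \<comment> \<open>Both \<beta> and its successor lie between the exponents of blocks
        \<open>Suc k\<close> and \<open>k\<close>, so the same \<open>n_prod\<close> expresses both
        values of \<open>V\<close>.\<close>
      then have "V \<beta> = P ^ (r_sum m k * \<beta>) / real (n_prod p \<alpha> m k)"
        "V (\<beta> + 1) = P ^ r_sum m k * P ^ (r_sum m k * \<beta>) / real (n_prod p \<alpha> m k)"
        using V[of \<beta>] V[of "\<beta> + 1"] by (auto simp: power_add)
      then show "(P ^ r_sum m k - 1) / real (n_prod p \<alpha> m k) * P ^ ((r_sum m k - 1) * \<beta>) =
        (V (\<beta> + 1) - V \<beta>) / P ^ \<beta>"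
        unfolding power_r_sum_minus_1[OF k(1)] by (simp add: diff_divide_distrib left_diff_distrib)
    qed
    finally have mu: "mu_term p \<alpha> m (Suc k) - mu_term p \<alpha> m k = \<dots>" .
    \<comment> \<open>The change of the leading term is telescoped over the same range; on combining
      it with the change of \<open>mu_term\<close>, the terms \<open>V \<beta> / P ^ \<beta>\<close>
      cancel.\<close>
    have "V (\<alpha> k) / P ^ \<alpha> k - V (\<alpha> (Suc k)) / P ^ \<alpha> (Suc k) =
      (\<Sum>\<beta>\<in>{\<alpha> (Suc k)..<\<alpha> k}. V (Suc \<beta>) / P ^ Suc \<beta> - V \<beta> / P ^ \<beta>)"
      using sum_Suc_diff'[of "\<alpha> (Suc k)" "\<alpha> k" "\<lambda>\<beta>. V \<beta> / P ^ \<beta>"] dec by simp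
    with mu have "?lhs (Suc k) - ?lhs k =
      (\<Sum>\<beta>\<in>{\<alpha> (Suc k)..<\<alpha> k}. (V (\<beta> + 1) - V \<beta>) / P ^ \<beta> -
        (V (Suc \<beta>) / P ^ Suc \<beta> - V \<beta> / P ^ \<beta>))"
      unfolding lhs[OF k(1)] lhs[OF k(2)] sum_subtractf by simp
    also have "\<dots> = (1 - 1 / P) * (\<Sum>\<beta>\<in>{\<alpha> (Suc k)..<\<alpha> k}. V (\<beta> + 1) / P ^ \<beta>)"
      unfolding sum_distrib_left by (rule sum.cong) (simp_all add: field_simps)
    finally have "?lhs (Suc k) = ?lhs k + \<dots>" by simp
    moreover have "\<alpha> k \<le> A" using \<alpha>_antimono[of 1 k] k assms(2) by simp
    then have "(\<Sum>\<beta>\<in>{\<alpha> (Suc k)..<A}. V (\<beta> + 1) / P ^ \<beta>) =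
      (\<Sum>\<beta>\<in>{\<alpha> (Suc k)..<\<alpha> k}. V (\<beta> + 1) / P ^ \<beta>) + (\<Sum>\<beta>\<in>{\<alpha> k..<A}. V (\<beta> + 1) / P ^ \<beta>)"
      using dec by (simp add: sum.atLeastLessThan_concat)
    ultimately show ?case unfolding IH by (simp add: distrib_left)
  qed
qed

text \<open>The exponents decrease, so the blocks with \<open>\<alpha> k \<le> b\<close> form a
  final segment and their weights telescope; the multiplicities before that segment add up to the
  exponent on the right.\<close>

lemma sum_block_weights:
  assumes "j \<le> s"
  shows "(\<Sum>k=1..j. if \<alpha> k \<le> b then 1 / P ^ r_sum m (k - 1) - 1 / P ^ r_sum m k else 0) =
    1 / P ^ (\<Sum>i=1..j. if b < \<alpha> i then m i else 0) - 1 / P ^ r_sum m j"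
  using assms
proof (induction j)
  case (Suc j)
  show ?case
  proof (cases "\<alpha> (Suc j) \<le> b")
    case True
    then show ?thesis using Suc by simp
  next
    case False
    have lt: "b < \<alpha> i" if "i \<in> {1..Suc j}" for i
      using False \<alpha>_antimono[of i "Suc j"] that Suc.prems by auto
    have "(\<Sum>k=1..Suc j. if \<alpha> k \<le> b then 1 / P ^ r_sum m (k - 1) - 1 / P ^ r_sum m k else 0) = 0"
      by (rule sum.neutral) (use lt in \<open>simp add: not_le[symmetric]\<close>)
    moreover have "(\<Sum>i=1..Suc j. if b < \<alpha> i then m i else 0) = r_sum m (Suc j)"
      unfolding r_sum_def by (rule sum.cong) (use lt in simp_all)
    ultimately show ?thesis by (simp only:)
  qed
qed (simp add: r_sum_def)

text \<open>Passing from \<open>b + 1\<close> to \<open>b\<close> raises \<open>W\<close> by the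
  multiplicities of the blocks with exponent above \<open>b\<close>, which is the exponent in
  \<open>sum_block_weights\<close>.\<close>

lemma V_mult_block_weights:
  "V (b + 1) * (\<Sum>k=1..s. if \<alpha> k \<le> b then 1 / P ^ r_sum m (k - 1) - 1 / P ^ r_sum m k else 0) =
    V b - V (b + 1) / P ^ r_sum m s"
proof -
  have "W b = W (b + 1) + (\<Sum>i=1..s. if b < \<alpha> i then m i else 0)"
    unfolding W_def sum.distrib[symmetric]
  proof (rule sum.cong[OF refl])
    fix i
    have "\<alpha> i - b = Suc (\<alpha> i - (b + 1))" if "b < \<alpha> i" using that by simp
    then show "m i * (\<alpha> i - b) = m i * (\<alpha> i - (b + 1)) + (if b < \<alpha> i then m i else 0)"
      by simp
  qed
  then show ?thesis
    unfolding sum_block_weights[OF order_refl] V_def by (simp add: power_add right_diff_distrib)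
qed

text \<open>The number of elements killed by \<open>p ^ b\<close> that are not \<open>p\<close>-th powers.\<close>

definition D :: "nat \<Rightarrow> real" where
  "D b = P ^ (\<Sum>i=1..s. m i * min (\<alpha> i) b) - P ^ (\<Sum>i=1..s. m i * min (\<alpha> i - 1) b)"

text \<open>The \<open>p\<close>-th powers form a subgroup of order \<open>n / p ^ r\<close>, and
  their \<open>p ^ b\<close>-th powers are the \<open>p ^ (b + 1)\<close>-th powers of the group.
  This explains the shift to \<open>V (b + 1)\<close>.\<close>

lemma D_eq: "D b = real (n_prod p \<alpha> m s) * (V b - V (b + 1) / P ^ r_sum m s)"
proof -
  let ?E = "\<Sum>i=1..s. m i * \<alpha> i"
  have "(\<Sum>i=1..s. m i * min (\<alpha> i) b) + W b = ?E"
    unfolding W_def sum.distrib[symmetric] by (rule sum.cong) (auto simp flip: distrib_left)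
  moreover have "(\<Sum>i=1..s. m i * min (\<alpha> i - 1) b) + W (b + 1) + r_sum m s = ?E"
    unfolding W_def r_sum_def sum.distrib[symmetric]
  proof (rule sum.cong[OF refl])
    fix i assume "i \<in> {1..s}"
    then have "min (\<alpha> i - 1) b + (\<alpha> i - (b + 1)) + 1 = \<alpha> i" using \<alpha>_pos[of i] by simp
    then show "m i * min (\<alpha> i - 1) b + m i * (\<alpha> i - (b + 1)) + m i = m i * \<alpha> i"
      by (metis distrib_left mult.right_neutral)
  qed
  ultimately have "P ^ ?E = P ^ (\<Sum>i=1..s. m i * min (\<alpha> i) b) * P ^ W b"
    "P ^ ?E = P ^ (\<Sum>i=1..s. m i * min (\<alpha> i - 1) b) * P ^ W (b + 1) * P ^ r_sum m s"
    by (simp_all flip: power_add)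
  then show ?thesis
    unfolding D_def n_prod_def V_def of_nat_power right_diff_distrib
    by (simp add: field_simps)
qed

lemma mu_formula_eq:
  assumes A: "A \<ge> \<alpha> 1"
  shows "mu_formula p s \<alpha> m = (\<Sum>b=1..A. (D b - D (b - 1)) / real (p ^ (b - 1) * (p - 1)))"
proof -
  let ?n = "real (n_prod p \<alpha> m s)" and ?r = "r_sum m s"
  let ?w = "\<lambda>k. 1 / P ^ r_sum m (k - 1) - 1 / P ^ r_sum m k"
  define e where "e k = P ^ ((r_sum m k - 1) * \<alpha> k) / real (n_prod p \<alpha> m k) + mu_term p \<alpha> m k" for k
  have "mu_formula p s \<alpha> m = ?n * (\<Sum>t=1..?r. e (block_index s m t) / P ^ (t - 1))"
    unfolding mu_formula_def e_def Let_def sum_distrib_left by (intro sum.cong) simp_all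
  then have "mu_formula p s \<alpha> m * (1 - 1 / P) = ?n * (\<Sum>k=1..s. e k * ?w k)"
    using sum_block_index[of P s s e m] by (simp add: mult.assoc)
  \<comment> \<open>Each tail sum is extended to all \<open>b < A\<close> by an indicator, so that
    the sums over \<open>k\<close> and \<open>b\<close> can be exchanged.\<close>
  also have "(\<Sum>k=1..s. e k * ?w k) =
    (\<Sum>k=1..s. 1 / P ^ A * ?w k +
      (\<Sum>b<A. (1 - 1 / P) * (V (b + 1) / P ^ b) * (if \<alpha> k \<le> b then ?w k else 0)))"
  proof (rule sum.cong[OF refl])
    fix k assume "k \<in> {1..s}"
    then have "e k = 1 / P ^ A + (1 - 1 / P) * (\<Sum>b\<in>{\<alpha> k..<A}. V (b + 1) / P ^ b)"
      unfolding e_def using A by (rule mu_summand_eq)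
    moreover have "(\<Sum>b\<in>{\<alpha> k..<A}. V (b + 1) / P ^ b) = (\<Sum>b<A. if \<alpha> k \<le> b then V (b + 1) / P ^ b else 0)"
      by (rule sum.mono_neutral_cong_left) auto
    ultimately have "e k * ?w k = 1 / P ^ A * ?w k +
      (\<Sum>b<A. (1 - 1 / P) * (if \<alpha> k \<le> b then V (b + 1) / P ^ b else 0) * ?w k)"
      by (simp only: distrib_right sum_distrib_left sum_distrib_right)
    also have "\<dots> = 1 / P ^ A * ?w k +
      (\<Sum>b<A. (1 - 1 / P) * (V (b + 1) / P ^ b) * (if \<alpha> k \<le> b then ?w k else 0))"
      by (intro arg_cong2[of _ _ _ _ "(+)"] sum.cong refl) simp
    finally show "e k * ?w k = \<dots>" .
  qed
  also have "\<dots> = 1 / P ^ A * (\<Sum>k=1..s. ?w k) +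
    (\<Sum>b<A. (1 - 1 / P) * (V (b + 1) / P ^ b) * (\<Sum>k=1..s. if \<alpha> k \<le> b then ?w k else 0))"
    unfolding sum.distrib sum_distrib_left by (simp only: sum.swap[of _ "{1..s}"])
  also have "(\<Sum>k=1..s. ?w k) = 1 - 1 / P ^ ?r"
    using sum_telescope''[of 0 s "\<lambda>k. - 1 / P ^ r_sum m k"] by (simp add: r_sum_def atLeastSucAtMost_greaterThanAtMost)
  also have "(\<Sum>b<A. (1 - 1 / P) * (V (b + 1) / P ^ b) * (\<Sum>k=1..s. if \<alpha> k \<le> b then ?w k else 0)) =
    (\<Sum>b<A. (1 - 1 / P) * ((V b - V (b + 1) / P ^ ?r) / P ^ b))"
    unfolding V_mult_block_weights[symmetric] by (intro sum.cong) simp_all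
  also have "\<dots> = (1 - 1 / P) * (\<Sum>b<A. (V b - V (b + 1) / P ^ ?r) / P ^ b)"
    by (rule sum_distrib_left[symmetric])
  finally have mu: "mu_formula p s \<alpha> m * (1 - 1 / P) =
    ?n * (1 / P ^ A * (1 - 1 / P ^ ?r) + (1 - 1 / P) * (\<Sum>b<A. (V b - V (b + 1) / P ^ ?r) / P ^ b))" .
  \<comment> \<open>Beyond the largest exponent both values of \<open>V\<close> are 1, which
    supplies the boundary term of the summation by parts.\<close>
  have "D A = ?n * (1 - 1 / P ^ ?r)" using A by (simp add: D_eq V_eq_1)
  moreover have "(\<Sum>b<A. D b / P ^ b) = ?n * (\<Sum>b<A. (V b - V (b + 1) / P ^ ?r) / P ^ b)"
    by (simp add: D_eq sum_distrib_left)
  moreover have "D 0 = 0" by (simp add: D_def)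
  ultimately have parts: "(\<Sum>b=1..A. (D b - D (b - 1)) / P ^ b) = mu_formula p s \<alpha> m * (1 - 1 / P)"
    unfolding mu sum_by_parts_power[OF P_pos] by (simp add: distrib_left)
  \<comment> \<open>For \<open>b \<ge> 1\<close> the totient \<open>p ^ (b - 1) * (p - 1)\<close> is
    \<open>P ^ b * (1 - 1 / P)\<close>, so the extra factor leaves plain powers of
    \<open>P\<close>.\<close>
  have "(\<Sum>b=1..A. (D b - D (b - 1)) / real (p ^ (b - 1) * (p - 1))) * (1 - 1 / P) =
    (\<Sum>b=1..A. (D b - D (b - 1)) / P ^ b)"
    unfolding sum_distrib_right
  proof (rule sum.cong[OF refl])
    fix b assume "b \<in> {1..A}"
    then obtain c where "b = Suc c" by (cases b) auto
    then show "(D b - D (b - 1)) / real (p ^ (b - 1) * (p - 1)) * (1 - 1 / P) = (D b - D (b - 1)) / P ^ b"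
      using p_gt_1 by (simp add: of_nat_diff divide_simps)
  qed
  then have eq: "mu_formula p s \<alpha> m * (1 - 1 / P) =
    (\<Sum>b=1..A. (D b - D (b - 1)) / real (p ^ (b - 1) * (p - 1))) * (1 - 1 / P)"
    by (simp only: parts)
  have "1 - 1 / P \<noteq> 0" using P_gt_1 by simp
  then show ?thesis using eq by (rule mult_right_cancel[THEN iffD1])
qed

end

section \<open>Matching the count with the formula\<close>

lemma (in comm_group) num_maximal_cyclic_p_group:
  assumes fin: "finite (carrier G)" and p: "prime p" and order: "order G = p ^ a" "a > 0"
    and type: "abelian_p_type p s \<alpha> m" and iso: "G \<cong> abelian_p_group p s \<alpha> m"
  shows "real (num_maximal_cyclic G) = mu_formula p s \<alpha> m"
proof -
  interpret type: abelian_p_type p s \<alpha> m by (rule type)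
  \<comment> \<open>Large enough for both uses: \<open>p ^ A\<close> kills the group and
    \<open>A\<close> is at least \<open>\<alpha> 1\<close>.\<close>
  define A where "A = a + \<alpha> 1"
  have "order G dvd p ^ A" by (simp add: order A_def power_add)
  then have "x [^] (p ^ A) = \<one>" if "x \<in> carrier G" for x
    using that ord_dvd_group_order[OF that] by (simp add: pow_eq_id dvd_trans)
  then have exponent: "torsion G (p ^ A) = carrier G" by (auto simp: torsion_def)
  have nontrivial: "carrier G \<noteq> {\<one>}"
  proof
    assume "carrier G = {\<one>}"
    then have "p ^ a = 1" using order by (simp add: order_def)
    then show False using p order(2) by simp
  qed
  have card: "card (power_torsion G (p ^ c) (p ^ b)) = p ^ (\<Sum>i=1..s. m i * min (\<alpha> i - c) b)"
    if "c \<le> 1" for b c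
  proof -
    have "card (power_torsion G (p ^ c) (p ^ b)) =
      card (power_torsion (abelian_p_group p s \<alpha> m) (p ^ c) (p ^ b))"
      by (rule card_power_torsion_iso[OF iso is_group group_abelian_p_group])
    also have "\<dots> = p ^ (\<Sum>i=1..s. m i * min (\<alpha> i - c) b)"
    proof (rule card_power_torsion_abelian_p_group)
      show "c \<le> \<alpha> i" if "i \<in> {1..s}" for i
        using type.\<alpha>_pos[OF that] \<open>c \<le> 1\<close> by simp
    qed simp
    finally show ?thesis .
  qed
  \<comment> \<open>The case \<open>c = 0\<close> counts all elements killed by
    \<open>p ^ b\<close>, and \<open>c = 1\<close> the \<open>p\<close>-th powers among
    them.\<close>
  have D: "real (card (torsion G (p ^ b) - (\<lambda>y. y [^] p) ` carrier G)) = type.D b" for b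
  proof -
    have "(\<lambda>x. x [^] (1::nat)) ` carrier G = carrier G" by simp
    then have T: "torsion G (p ^ b) = power_torsion G (p ^ 0) (p ^ b)"
      unfolding torsion_def power_torsion_def by simp
    have I: "torsion G (p ^ b) \<inter> (\<lambda>y. y [^] p) ` carrier G = power_torsion G (p ^ 1) (p ^ b)"
      unfolding torsion_def power_torsion_def by auto
    have finT: "finite (torsion G (p ^ b))" using fin by (simp add: torsion_def)
    have "card (torsion G (p ^ b) - (\<lambda>y. y [^] p) ` carrier G) =
      card (power_torsion G (p ^ 0) (p ^ b)) - card (power_torsion G (p ^ 1) (p ^ b))"
      unfolding I[symmetric] T[symmetric] using finT by (intro card_Diff_subset_Int) simp
    moreover have "card (power_torsion G (p ^ 1) (p ^ b)) \<le> card (power_torsion G (p ^ 0) (p ^ b))"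
      unfolding I[symmetric] T[symmetric] using finT by (intro card_mono) auto
    ultimately show ?thesis by (simp only: card type.D_def of_nat_diff) simp
  qed
  show ?thesis
    using num_maximal_cyclic_eq_sum_orders[OF fin p exponent nontrivial] type.mu_formula_eq[of A]
    unfolding D by (simp add: A_def)
qed

theorem corollary3p11:
  fixes G :: "('a, 'b) monoid_scheme" and P :: "nat \<Rightarrow> 'a set"
  assumes "comm_group G" and "finite (carrier G)"
    and "\<And>p. p \<in> prime_factors (order G) \<Longrightarrow> sylow_subgroup p (P p) G"
  shows "independence_number (enhanced_power_graph G) =
           (\<Prod>p\<in>prime_factors (order G). num_maximal_cyclic (G\<lparr>carrier := P p\<rparr>)) \<and>
         (\<forall>p\<in>prime_factors (order G). \<forall>s \<alpha> m.
            1 \<le> s \<and>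
            (\<forall>i\<in>{1..s}. 0 < \<alpha> i \<and> 0 < m i) \<and>
            (\<forall>i\<in>{1..s}. \<forall>j\<in>{1..s}. i < j \<longrightarrow> \<alpha> i > \<alpha> j) \<and>
            G\<lparr>carrier := P p\<rparr> \<cong> abelian_p_group p s \<alpha> m \<longrightarrow>
            real (num_maximal_cyclic (G\<lparr>carrier := P p\<rparr>)) = mu_formula p s \<alpha> m)"
proof (intro conjI ballI allI impI)
  interpret comm_group G by fact
  show "independence_number (enhanced_power_graph G) =
    (\<Prod>p\<in>prime_factors (order G). num_maximal_cyclic (G\<lparr>carrier := P p\<rparr>))"
    unfolding independence_number_enhanced_power_graph[OF assms(2)]
    by (rule num_maximal_cyclic_sylow[OF assms(2,3)])
  fix p s \<alpha> m
  assume p: "p \<in> prime_factors (order G)" and type: "1 \<le> s \<and>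
      (\<forall>i\<in>{1..s}. 0 < \<alpha> i \<and> 0 < m i) \<and>
      (\<forall>i\<in>{1..s}. \<forall>j\<in>{1..s}. i < j \<longrightarrow> \<alpha> i > \<alpha> j) \<and>
      G\<lparr>carrier := P p\<rparr> \<cong> abelian_p_group p s \<alpha> m"
  have prime: "prime p" and sub: "subgroup (P p) G"
    and card: "card (P p) = p ^ multiplicity p (order G)"
    using assms(3)[OF p] by (auto simp: sylow_subgroup_def)
  interpret S: comm_group "G\<lparr>carrier := P p\<rparr>"
    by (rule group.group_comm_groupI[OF subgroup_imp_group[OF sub]])
      (simp add: m_comm subgroup.mem_carrier[OF sub])
  show "real (num_maximal_cyclic (G\<lparr>carrier := P p\<rparr>)) = mu_formula p s \<alpha> m"
  proof (rule S.num_maximal_cyclic_p_group)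
    show "finite (carrier (G\<lparr>carrier := P p\<rparr>))"
      using finite_subset[OF subgroup.subset[OF sub] assms(2)] by simp
    show "order (G\<lparr>carrier := P p\<rparr>) = p ^ multiplicity p (order G)" by (simp add: order_def card)
    show "multiplicity p (order G) > 0" using p by (simp add: prime_factors_multiplicity)
    show "abelian_p_type p s \<alpha> m"
      using type prime_gt_1_nat[OF prime] by unfold_locales auto
  qed (use prime type in auto)
qed

end
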